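(* Let $k$ be an algebraically closed field of characteristic zero, $n>1$ and $\mathbf{x}=(x_1,\dots,x_n)$. The ring $k[[\mathbf{x}]]^{*}$ is integrally closed in its quotient field.
   Context: For $1\le i<j\le n$, the order-preserving monomial blowing-up $\varphi_{ij}$ is the linear automorphism of $\mathbb{R}^n$ which replaces the $j$-th coordinate $a_j$ of $(a_1,\dots,a_n)$ by $a_i+a_j$ and leaves the other coordinates unchanged; its inverse is an order-preserving monomial blowing-down. $\mathcal{S}$ is the set of finite compositions of order-preserving monomial blowing-downs of $\mathbb{R}^n$ and $\Lambda=\{\Phi(\mathbb{R}_{\ge0}^n):\Phi\in\mathcal{S}\}$. $K_{n,d}=k((x_n^{1/d}))\cdots((x_1^{1/d}))$ is the field of iterated formal Laurent series ($K_{1,d}=k((x_1^{1/d}))$, and $K_{n,d}=L((x_1^{1/d}))$ with $L=k((x_n^{1/d}))\cdots((x_2^{1/d}))$), whose elements are regarded as formal sums $f=\sum_{\mathbf{a}\in\mathbb{Z}^n}f_{\mathbf{a}}\mathbf{x}^{\mathbf{a}/d}$, $f_{\mathbf{a}}\in k$, with Newton diagram $\mathcal{E}(f)=\{\mathbf{a}/d: f_{\mathbf{a}}\neq0\}$; when $d\mid d'$, $K_{n,d}\subset K_{n,d'}$ in the obvious way. For $\Gamma\in\Lambda$ and $d\in\mathbb{Z}_{>0}$, $k[[\Gamma,d]]$ is the subring of $K_{n,d}$ consisting of the series $f$ with $\mathcal{E}(f)\subset\Gamma$. These rings form a direct system under inclusion, and $k[[\mathbf{x}]]^{*}=\bigcup_{(\Gamma,d)\in\Lambda\times\mathbb{Z}_{>0}}k[[\Gamma,d]]$.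 *)

theory Defs
  imports "HOL-Algebra.Ring" "HOL-Computational_Algebra.Polynomial"
begin

text \<open>
  Points of \<open>\<real>\<^sup>n\<close> and exponent vectors are lists of length \<open>n\<close>. Positions are counted from 0, so
  the coordinate \<open>a\<^sub>1\<close> is \<open>a ! 0\<close>.
\<close>

section \<open>Monomial blowings-up and the cones\<close>

definition Rn :: "nat \<Rightarrow> real list set" where
  "Rn n = {a. length a = n}"

definition orthant :: "nat \<Rightarrow> real list set" where
  "orthant n = {a \<in> Rn n. \<forall>i<n. a ! i \<ge> 0}"

definition blow_up :: "nat \<Rightarrow> nat \<Rightarrow> real list \<Rightarrow> real list" where
  "blow_up i j a = a[j := a ! i + a ! j]"

definition blow_down :: "nat \<Rightarrow> nat \<Rightarrow> real list \<Rightarrow> real list" where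
  "blow_down i j a = a[j := a ! j - a ! i]"

lemma blow_down_inverse:
  assumes "i < j" "j < n" "a \<in> Rn n"
  shows "blow_down i j (blow_up i j a) = a" "blow_up i j (blow_down i j a) = a"
  using assms by (simp_all add: blow_up_def blow_down_def Rn_def)

inductive_set blow_down_comps :: "nat \<Rightarrow> (real list \<Rightarrow> real list) set" for n where
  empty: "id \<in> blow_down_comps n"
| comp: "\<Phi> \<in> blow_down_comps n \<Longrightarrow> i < j \<Longrightarrow> j < n \<Longrightarrow> blow_down i j \<circ> \<Phi> \<in> blow_down_comps n"

definition cones :: "nat \<Rightarrow> real list set set" where
  "cones n = {\<Phi> ` orthant n | \<Phi>. \<Phi> \<in> blow_down_comps n}"


section \<open>Iterated Laurent series\<close>

text \<open>
  A series is its coefficient function: \<open>f q\<close> is the coefficient of the monomial \<open>x\<^sup>q\<close>, \<open>q\<close> a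
  list of \<open>n\<close> rationals. Indexing by the actual exponent \<open>q = a / d\<close> rather than by \<open>a\<close> makes
  the embeddings for \<open>d dvd d'\<close> plain inclusions. The first variable is the outermost one: an
  element of \<open>iter_laurent (Suc n) d\<close> is a Laurent series in \<open>x\<^sub>1\<^bsup>1/d\<^esup>\<close>, whose coefficient
  at \<open>x\<^sub>1\<^bsup>p\<^esup>\<close>, namely \<open>\<lambda>q. f (p # q)\<close>, is an iterated Laurent series in the remaining variables.
\<close>

primrec iter_laurent :: "nat \<Rightarrow> nat \<Rightarrow> (rat list \<Rightarrow> 'k::field) set" where
  "iter_laurent 0 d = {f. \<forall>q. q \<noteq> [] \<longrightarrow> f q = 0}"
| "iter_laurent (Suc n) d = {f. f [] = 0 \<and> (\<forall>p. (\<lambda>q. f (p # q)) \<in> iter_laurent n d) \<and>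
     (\<exists>N::int. \<forall>p. (\<lambda>q. f (p # q)) \<noteq> (\<lambda>_. 0) \<longrightarrow> p \<in> {of_int m / of_nat d | m. m \<ge> N})}"

text \<open>
  The ring \<open>\<Union>\<^sub>d K\<^bsub>n,d\<^esub>\<close>, with the Cauchy product. The sum in the product is finite on the carrier
  (see \<open>finite_convolution\<close> below).
\<close>

definition series_ring :: "nat \<Rightarrow> (rat list \<Rightarrow> 'k::field) ring" where
  "series_ring n =
     \<lparr> carrier = (\<Union>d\<in>{0<..}. iter_laurent n d),
       monoid.mult = (\<lambda>f g a. \<Sum>(b, c) | f b \<noteq> 0 \<and> g c \<noteq> 0 \<and> map2 (+) b c = a. f b * g c),
       one = (\<lambda>a. if a = replicate n 0 then 1 else 0),
       zero = (\<lambda>a. 0),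
       add = (\<lambda>f g a. f a + g a) \<rparr>"

lemma iter_laurent_length:
  "f \<in> iter_laurent n d \<Longrightarrow> f q \<noteq> 0 \<Longrightarrow> length q = n"
proof (induction n arbitrary: f q)
  case (Suc n)
  then show ?case by (cases q) fastforce+
qed auto

lemma iter_laurent_mono:
  assumes "d dvd d'" "d' > 0"
  shows "iter_laurent n d \<subseteq> (iter_laurent n d' :: (rat list \<Rightarrow> 'k::field) set)"
proof (induction n)
  case (Suc n)
  obtain e where e: "d' = d * e" using assms by auto
  have pos: "d > 0" "e > 0" using assms e by auto
  show ?case
  proof
    fix f :: "rat list \<Rightarrow> 'k" assume f: "f \<in> iter_laurent (Suc n) d"
    then obtain N :: int where
      N: "\<And>p. (\<lambda>q. f (p # q)) \<noteq> (\<lambda>_. 0) \<Longrightarrow> \<exists>m\<ge>N. p = of_int m / of_nat d"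
      by fastforce
    have "\<exists>m'\<ge>N * int e. p = of_int m' / of_nat d'" if nz: "(\<lambda>q. f (p # q)) \<noteq> (\<lambda>_. 0)" for p
    proof -
      obtain m where m: "m \<ge> N" "p = of_int m / of_nat d" using N[OF nz] by blast
      then show ?thesis using pos e
        by (intro exI[of _ "m * int e"]) (auto simp: mult_right_mono)
    qed
    with f Suc show "f \<in> iter_laurent (Suc n) d'" by simp blast
  qed
qed simp

lemma finite_convolution:
  fixes f g :: "rat list \<Rightarrow> 'k::field"
  assumes "f \<in> carrier (series_ring n)" "g \<in> carrier (series_ring n)"
  shows "finite {(b, c). f b \<noteq> 0 \<and> g c \<noteq> 0 \<and> map2 (+) b c = a}"
proof -
  obtain d1 d2 where d12: "d1 > 0" "d2 > 0" "f \<in> iter_laurent n d1" "g \<in> iter_laurent n d2"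
    using assms by (auto simp: series_ring_def)
  define d where "d = d1 * d2"
  have d: "d > 0" and fg: "f \<in> iter_laurent n d" "g \<in> iter_laurent n d"
    using d12 iter_laurent_mono[of d1 d n] iter_laurent_mono[of d2 d n] by (auto simp: d_def)
  from fg show ?thesis
  proof (induction n arbitrary: f g a)
    case 0
    then have "{(b, c). f b \<noteq> 0 \<and> g c \<noteq> 0 \<and> map2 (+) b c = a} \<subseteq> {([], [])}" by auto
    then show ?case by (rule finite_subset) simp
  next
    case (Suc n)
    obtain N :: int where
      N: "\<And>p. (\<lambda>q. f (p # q)) \<noteq> (\<lambda>_. 0) \<Longrightarrow> \<exists>m\<ge>N. p = of_int m / of_nat d"
      using Suc.prems(1) by fastforce
    obtain M :: int where
      M: "\<And>p. (\<lambda>q. g (p # q)) \<noteq> (\<lambda>_. 0) \<Longrightarrow> \<exists>m\<ge>M. p = of_int m / of_nat d"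
      using Suc.prems(2) by fastforce
    let ?S = "\<lambda>f g a. {(b, c). f b \<noteq> (0::'k) \<and> g c \<noteq> (0::'k) \<and> map2 (+) b c = (a::rat list)}"
    show ?case
    proof (cases a)
      case Nil
      have "f [] = 0" "g [] = 0" using Suc.prems by auto
      then have "?S f g a = {}" using Nil by (auto simp: zip_eq_Nil_iff)
      then show ?thesis by (simp only: finite.emptyI)
    next
      case (Cons r a')
      define P where "P = (\<lambda>m. of_int m / of_nat d :: rat) ` {N..\<lfloor>r * of_nat d\<rfloor> - M}"
      define T where
        "T p = ?S (\<lambda>q. f (p # q)) (\<lambda>q. g ((r - p) # q)) a'" for p
      have "?S f g a \<subseteq> (\<Union>p\<in>P. (\<lambda>(b, c). (p # b, (r - p) # c)) ` T p)"
      proof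
        fix z assume "z \<in> ?S f g a"
        then obtain b c where z: "z = (b, c)" and
          bc: "f b \<noteq> 0" "g c \<noteq> 0" "map2 (+) b c = a" by auto
        obtain p b' where b: "b = p # b'" using Suc.prems(1) bc by (cases b) auto
        obtain p' c' where c: "c = p' # c'" using Suc.prems(2) bc by (cases c) auto
        have p': "p' = r - p" and a': "map2 (+) b' c' = a'" using bc b c Cons by auto
        have "(\<lambda>q. f (p # q)) \<noteq> (\<lambda>_. 0)" "(\<lambda>q. g (p' # q)) \<noteq> (\<lambda>_. 0)"
          using bc b c by metis+
        then obtain m m' where m: "m \<ge> N" "p = of_int m / of_nat d"
          and m': "m' \<ge> M" "p' = of_int m' / of_nat d" using N M by blast
        have "r * of_nat d = of_int (m + m')" using m m' p' d by (simp add: field_simps)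
        then have "m \<in> {N..\<lfloor>r * of_nat d\<rfloor> - M}"
          using m m' by (simp del: of_int_add)
        then have "p \<in> P" using m by (auto simp: P_def)
        moreover have "(b', c') \<in> T p" using bc b c p' a' by (simp add: T_def)
        ultimately show "z \<in> (\<Union>p\<in>P. (\<lambda>(b, c). (p # b, (r - p) # c)) ` T p)"
          using z b c p' by force
      qed
      moreover have "finite P" by (simp add: P_def)
      moreover have "finite (T p)" for p unfolding T_def
        using Suc.prems by (intro Suc.IH) auto
      ultimately show ?thesis by (meson finite_UN_I finite_imageI finite_subset)
    qed
  qed
qed

definition newton :: "(rat list \<Rightarrow> 'k::field) \<Rightarrow> real list set" where
  "newton f = {map of_rat q | q. f q \<noteq> 0}"

definition cone_series :: "nat \<Rightarrow> real list set \<Rightarrow> nat \<Rightarrow> (rat list \<Rightarrow> 'k::field) set" where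
  "cone_series n \<Gamma> d = {f \<in> iter_laurent n d. newton f \<subseteq> \<Gamma>}"

definition star_series :: "nat \<Rightarrow> (rat list \<Rightarrow> 'k::field) set" where
  "star_series n = (\<Union>\<Gamma>\<in>cones n. \<Union>d\<in>{0<..}. cone_series n \<Gamma> d)"


section \<open>Integral closedness\<close>

text \<open>For a subring \<open>A\<close> of a field \<open>K\<close>, the quotient field of \<open>A\<close> is realised inside \<open>K\<close>.\<close>

definition quotient_field :: "('a, 'b) ring_scheme \<Rightarrow> 'a set \<Rightarrow> 'a set" where
  "quotient_field K A = {a \<otimes>\<^bsub>K\<^esub> inv\<^bsub>K\<^esub> b | a b. a \<in> A \<and> b \<in> A - {\<zero>\<^bsub>K\<^esub>}}"

definition integral_over :: "('a, 'b) ring_scheme \<Rightarrow> 'a set \<Rightarrow> 'a \<Rightarrow> bool" where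
  "integral_over K A x \<longleftrightarrow> (\<exists>m>0. \<exists>c::nat \<Rightarrow> 'a. (\<forall>i<m. c i \<in> A) \<and>
     x [^]\<^bsub>K\<^esub> m \<oplus>\<^bsub>K\<^esub> (\<Oplus>\<^bsub>K\<^esub>i\<in>{..<m}. c i \<otimes>\<^bsub>K\<^esub> x [^]\<^bsub>K\<^esub> i) = \<zero>\<^bsub>K\<^esub>)"

definition integrally_closed :: "('a, 'b) ring_scheme \<Rightarrow> 'a set \<Rightarrow> bool" where
  "integrally_closed K A \<longleftrightarrow> (\<forall>x \<in> quotient_field K A. integral_over K A x \<longrightarrow> x \<in> A)"

end

theory Submission
  imports Defs
begin

text \<open>
  The ring \<open>A = k[[x]]\<^sup>*\<close> behaves like a valuation ring, and the proof is the one showing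
  that valuation rings are integrally closed. The role of the valuation is played by the
  lexicographically least exponent of a series, and everything rests on two facts about the cones.

  First, the cones are directed and large: any two lie in a third, and every rational vector or
  its negative lies in some cone. To see this it is convenient to replace them by one increasing
  sequence. The \<^emph>\<open>shear\<close> with parameter \<open>N\<close>, which sends \<open>u\<close> to the vector with entries
  \<open>u\<^sub>k - N * (u\<^sub>0 + \<dots> + u\<^bsub>k-1\<^esub>)\<close>, is a composition of blowings-down, and each cone is
  contained in the image of the orthant under the shear for \<open>N\<close> large
  (\<open>cone_subset_real_cone\<close>, \<open>shear_in_blow_down_comps\<close>). Hence a series lies in \<open>A\<close> iff
  its exponents lie in the set \<open>lattice_cone n d N\<close> of lattice points of one such image
  (\<open>star_series_iff\<close>).

  Secondly, if the exponents of a nonzero series lie in a translate of a cone, then they lie in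
  \<open>m + \<Gamma>\<close>, where \<open>m\<close> is one of these exponents and \<open>\<Gamma>\<close> is a possibly larger cone
  (\<open>least_exponent\<close>). Such a series is a monomial times a series in \<open>A\<close> with nonzero constant
  term, and the latter can be inverted in \<open>A\<close> (\<open>inverse_rooted\<close>). So an element \<open>x \<noteq> 0\<close> of
  the quotient field also has its exponents in \<open>e + \<Gamma>\<close> for one of its own exponents \<open>e\<close>. If
  \<open>e\<close> lies in a cone, then \<open>x\<close> lies in \<open>A\<close>. Otherwise \<open>-e\<close> does, and then \<open>x\<close> cannot
  satisfy a monic equation of degree \<open>m\<close> over \<open>A\<close>: the monomial \<open>m e\<close> occurs in \<open>x\<^sup>m\<close>, and
  its occurring in a term \<open>c\<^sub>i x\<^sup>i\<close> with \<open>i < m\<close> would put \<open>(m - i) e\<close>, hence \<open>e\<close>, in a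
  cone (\<open>integral_exponent\<close>).
\<close>


section \<open>Shears\<close>

definition shear :: "nat \<Rightarrow> (nat \<Rightarrow> 'a::comm_ring_1) \<Rightarrow> nat \<Rightarrow> 'a" where
  "shear N u k = u k - of_nat N * (\<Sum>l<k. u l)"

text \<open>
  A shear is inverted by solving for \<open>u\<^sub>k\<close> one entry at a time, and all that is needed of the
  previous entries is their sum, here computed directly from the image \<open>z\<close>.
\<close>

primrec unshear_sum :: "nat \<Rightarrow> (nat \<Rightarrow> 'a::comm_ring_1) \<Rightarrow> nat \<Rightarrow> 'a" where
  "unshear_sum N z 0 = 0"
| "unshear_sum N z (Suc k) = z k + (of_nat N + 1) * unshear_sum N z k"

definition unshear :: "nat \<Rightarrow> (nat \<Rightarrow> 'a::comm_ring_1) \<Rightarrow> nat \<Rightarrow> 'a" where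
  "unshear N z k = z k + of_nat N * unshear_sum N z k"

lemma sum_unshear: "(\<Sum>l<k. unshear N z l) = unshear_sum N z k"
  by (induction k) (simp_all add: unshear_def algebra_simps)

lemma shear_unshear [simp]: "shear N (unshear N z) k = z k"
  by (simp add: shear_def sum_unshear) (simp add: unshear_def)

lemma shear_determines:
  assumes "\<And>l. l < k \<Longrightarrow> shear N u l = shear N v l" "l < k"
  shows "u l = v l"
  using assms(2)
proof (induction l rule: less_induct)
  case (less l)
  then have "(\<Sum>i<l. u i) = (\<Sum>i<l. v i)" by (intro sum.cong) auto
  then show ?case using assms(1)[OF less.prems] by (simp add: shear_def)
qed

lemma shear_add: "shear N (\<lambda>k. u k + v k) k = shear N u k + shear N v k"
  by (simp add: shear_def sum.distrib algebra_simps)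

lemma shear_scale: "shear N (\<lambda>k. c * u k) k = c * shear N u k"
  by (simp add: shear_def sum_distrib_left[symmetric] algebra_simps)

lemma shear_of_int: "shear N (\<lambda>k. of_int (u k)) k = of_int (shear N u k)"
  by (simp add: shear_def)

text \<open>
  The inverse of a shear has nonnegative coefficients, so it is monotone. This is what turns
  inequalities into membership in a sheared orthant: it suffices to find some \<open>v \<ge> 0\<close> whose
  shear lies below the given vector.
\<close>

lemma unshear_ge:
  fixes v z :: "nat \<Rightarrow> 'a::linordered_idom"
  assumes "\<And>k. k < n \<Longrightarrow> shear N v k \<le> z k" "k < n"
  shows "v k \<le> unshear N z k"
  using assms(2)
proof (induction k rule: less_induct)
  case (less k)
  have "(\<Sum>l<k. v l) \<le> (\<Sum>l<k. unshear N z l)"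
    using less by (intro sum_mono) auto
  then have "of_nat N * (\<Sum>l<k. v l) \<le> of_nat N * unshear_sum N z k"
    unfolding sum_unshear by (intro mult_left_mono) auto
  with assms(1)[OF less.prems] show ?case by (simp add: shear_def unshear_def)
qed


section \<open>Sheared orthants are cofinal among the cones\<close>

definition real_cone :: "nat \<Rightarrow> nat \<Rightarrow> real list set" where
  "real_cone n N = {v. length v = n \<and> (\<exists>u. \<forall>k<n. 0 \<le> u k \<and> v ! k = shear N u k)}"

lemma real_coneI:
  assumes "length v = n" "\<And>k. k < n \<Longrightarrow> 0 \<le> u k" "\<And>k. k < n \<Longrightarrow> shear N u k \<le> v ! k"
  shows "v \<in> real_cone n N"
proof -
  have "u k \<le> unshear N (\<lambda>k. v ! k) k" if "k < n" for k
    using unshear_ge[where n = n] assms(3) that by blast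
  then have "\<forall>k<n. 0 \<le> unshear N (\<lambda>k. v ! k) k \<and> v ! k = shear N (unshear N (\<lambda>k. v ! k)) k"
    using assms(2) by (auto intro: order_trans)
  then show ?thesis using assms(1) unfolding real_cone_def by blast
qed

text \<open>
  A blowing-down subtracts from entry \<open>j\<close> an earlier entry \<open>v\<^sub>i \<le> u\<^sub>i\<close>, and \<open>u\<^sub>i\<close> is one
  of the summands that the next shear subtracts from entry \<open>j\<close> once more.
\<close>

lemma blow_down_real_cone:
  assumes v: "v \<in> real_cone n N" and ij: "i < j" "j < n"
  shows "blow_down i j v \<in> real_cone n (Suc N)"
proof -
  obtain u where u: "\<And>k. k < n \<Longrightarrow> 0 \<le> u k" "\<And>k. k < n \<Longrightarrow> v ! k = shear N u k"
    and len: "length v = n"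
    using v by (auto simp: real_cone_def)
  have pos: "0 \<le> (\<Sum>l<k. u l)" if "k \<le> n" for k
    using u(1) that by (intro sum_nonneg) auto
  have ui: "u i \<le> (\<Sum>l<j. u l)"
    using u(1) ij by (intro member_le_sum) auto
  show ?thesis
  proof (rule real_coneI)
    show "length (blow_down i j v) = n" using len by (simp add: blow_down_def)
    fix k assume k: "k < n"
    show "0 \<le> u k" using u(1) k by blast
    show "shear (Suc N) u k \<le> blow_down i j v ! k"
    proof (cases "k = j")
      case True
      have "0 \<le> real N * (\<Sum>l<i. u l)" using pos[of i] ij by simp
      then show ?thesis
        using True u(2)[of j] u(2)[of i] ij ui len
        by (simp add: blow_down_def shear_def algebra_simps)
    next
      case False
      then show ?thesis using u(2)[OF k] pos[of k] k
        by (simp add: blow_down_def shear_def algebra_simps)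
    qed
  qed
qed

lemma cone_subset_real_cone:
  assumes "\<Gamma> \<in> cones n"
  shows "\<exists>N. \<Gamma> \<subseteq> real_cone n N"
proof -
  obtain \<Phi> where \<Phi>: "\<Phi> \<in> blow_down_comps n" "\<Gamma> = \<Phi> ` orthant n"
    using assms by (auto simp: cones_def)
  from \<Phi>(1) have "\<exists>N. \<Phi> ` orthant n \<subseteq> real_cone n N"
  proof induction
    case empty
    have "orthant n \<subseteq> real_cone n 0"
      by (auto simp: orthant_def Rn_def intro!: real_coneI[where u = "\<lambda>k. _ ! k"] simp: shear_def)
    then show ?case by auto
  next
    case (comp \<Phi> i j)
    then obtain N where "\<Phi> ` orthant n \<subseteq> real_cone n N" by blast
    then have "(blow_down i j \<circ> \<Phi>) ` orthant n \<subseteq> real_cone n (Suc N)"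
      using blow_down_real_cone comp.hyps by (auto simp: image_subset_iff)
    then show ?case by blast
  qed
  with \<Phi>(2) show ?thesis by simp
qed

lemma blow_down_funpow:
  assumes "i < j" "j < length a"
  shows "(blow_down i j ^^ N) a = a[j := a ! j - real N * a ! i]"
  using assms by (induction N) (simp_all add: blow_down_def algebra_simps)

lemma blow_down_funpow_comps:
  assumes "\<Phi> \<in> blow_down_comps n" "i < j" "j < n"
  shows "(blow_down i j ^^ N) \<circ> \<Phi> \<in> blow_down_comps n"
proof (induction N)
  case (Suc N)
  have "(blow_down i j ^^ Suc N) \<circ> \<Phi> = blow_down i j \<circ> ((blow_down i j ^^ N) \<circ> \<Phi>)"
    by (simp add: comp_assoc)
  with Suc show ?case
    using blow_down_comps.comp[OF _ assms(2,3)] by metis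
qed (simp add: assms)

text \<open>
  Subtracting \<open>N\<close> times each of the first \<open>m\<close> entries from entry \<open>j \<ge> m\<close> leaves these
  entries alone, so the subtractions can be carried out one after the other.
\<close>

lemma row_operation_comps:
  assumes "\<Phi> \<in> blow_down_comps n" "j < n" "m \<le> j"
    "\<And>a. a \<in> Rn n \<Longrightarrow> \<Phi> a \<in> Rn n"
  shows "\<exists>\<Psi>\<in>blow_down_comps n.
    \<forall>a\<in>Rn n. \<Psi> a = (\<Phi> a)[j := \<Phi> a ! j - real N * (\<Sum>l<m. \<Phi> a ! l)]"
  using assms(3)
proof (induction m)
  case 0
  show ?case using assms(1) by (intro bexI[of _ \<Phi>]) auto
next
  case (Suc m)
  then obtain \<Psi> where \<Psi>: "\<Psi> \<in> blow_down_comps n"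
    "\<And>a. a \<in> Rn n \<Longrightarrow> \<Psi> a = (\<Phi> a)[j := \<Phi> a ! j - real N * (\<Sum>l<m. \<Phi> a ! l)]"
    by auto
  show ?case
  proof (intro bexI ballI)
    show "(blow_down m j ^^ N) \<circ> \<Psi> \<in> blow_down_comps n"
      using \<Psi>(1) Suc.prems assms(2) by (intro blow_down_funpow_comps) auto
    fix a assume a: "a \<in> Rn n"
    then have "length (\<Phi> a) = n" using assms(4) by (auto simp: Rn_def)
    then show "((blow_down m j ^^ N) \<circ> \<Psi>) a
        = (\<Phi> a)[j := \<Phi> a ! j - real N * (\<Sum>l<Suc m. \<Phi> a ! l)]"
      using Suc.prems assms(2) a by (simp add: \<Psi>(2) blow_down_funpow algebra_simps)
  qed
qed

text \<open>
  The entries are treated from the last to the first, so that each of them is modified while the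
  earlier ones still have their original values, as the definition of the shear requires.
\<close>

lemma shear_in_blow_down_comps:
  "\<exists>\<Phi>\<in>blow_down_comps n. \<forall>a\<in>Rn n. \<Phi> a = map (shear N (\<lambda>k. a ! k)) [0..<n]"
proof -
  have "\<exists>\<Phi>\<in>blow_down_comps n. \<forall>a\<in>Rn n.
      \<Phi> a = map (\<lambda>k. if n - j \<le> k then shear N (\<lambda>k. a ! k) k else a ! k) [0..<n]"
    if "j \<le> n" for j
    using that
  proof (induction j)
    case 0
    have "a = map (\<lambda>k. if n - 0 \<le> k then shear N (\<lambda>k. a ! k) k else a ! k) [0..<n]"
      if "a \<in> Rn n" for a :: "real list"
      using that by (auto simp: Rn_def intro!: nth_equalityI)
    then show ?case using blow_down_comps.empty[of n] by (intro bexI[of _ id]) auto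
  next
    case (Suc j)
    then obtain \<Phi> where \<Phi>: "\<Phi> \<in> blow_down_comps n" "\<And>a. a \<in> Rn n \<Longrightarrow>
        \<Phi> a = map (\<lambda>k. if n - j \<le> k then shear N (\<lambda>k. a ! k) k else a ! k) [0..<n]"
      by auto
    define r where "r = n - Suc j"
    have r: "r < n" "n - j = Suc r" using Suc.prems by (auto simp: r_def)
    obtain \<Psi> where \<Psi>: "\<Psi> \<in> blow_down_comps n" "\<And>a. a \<in> Rn n \<Longrightarrow>
        \<Psi> a = (\<Phi> a)[r := \<Phi> a ! r - real N * (\<Sum>l<r. \<Phi> a ! l)]"
      using row_operation_comps[OF \<Phi>(1) r(1) order_refl, of N] \<Phi>(2)
      by (auto simp: Rn_def)
    have "\<Psi> a = map (\<lambda>k. if r \<le> k then shear N (\<lambda>k. a ! k) k else a ! k) [0..<n]"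
      if a: "a \<in> Rn n" for a
    proof (rule nth_equalityI)
      have "(\<Sum>l<r. \<Phi> a ! l) = (\<Sum>l<r. a ! l)"
        using r by (intro sum.cong) (auto simp: \<Phi>(2)[OF a])
      then show "\<Psi> a ! k = map (\<lambda>k. if r \<le> k then shear N (\<lambda>k. a ! k) k else a ! k) [0..<n] ! k"
        if "k < length (\<Psi> a)" for k
        using that r a
        by (cases "k = r") (auto simp: \<Psi>(2) \<Phi>(2) shear_def)
    qed (use a in \<open>simp add: \<Psi>(2) \<Phi>(2)\<close>)
    with \<Psi>(1) show ?case unfolding r_def by blast
  qed
  from this[OF order_refl] show ?thesis by simp
qed


section \<open>Lattice points of the sheared orthants\<close>

definition vadd :: "rat list \<Rightarrow> rat list \<Rightarrow> rat list" (infixl "\<boxplus>" 65) where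
  "p \<boxplus> q = map2 (+) p q"

definition vneg :: "rat list \<Rightarrow> rat list" where
  "vneg p = map uminus p"

lemma length_vadd [simp]: "length (p \<boxplus> q) = min (length p) (length q)"
  by (simp add: vadd_def)

lemma nth_vadd [simp]: "k < length p \<Longrightarrow> k < length q \<Longrightarrow> (p \<boxplus> q) ! k = p ! k + q ! k"
  by (simp add: vadd_def)

lemma length_vneg [simp]: "length (vneg p) = length p"
  by (simp add: vneg_def)

lemma nth_vneg [simp]: "k < length p \<Longrightarrow> vneg p ! k = - p ! k"
  by (simp add: vneg_def)

lemma vadd_commute: "p \<boxplus> q = q \<boxplus> p"
  by (rule nth_equalityI) auto

lemma vadd_assoc: "p \<boxplus> q \<boxplus> r = p \<boxplus> (q \<boxplus> r)"
  by (rule nth_equalityI) auto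

lemma vadd_left_commute: "p \<boxplus> (q \<boxplus> r) = q \<boxplus> (p \<boxplus> r)"
  by (metis vadd_assoc vadd_commute)

lemmas vadd_ac = vadd_assoc vadd_commute vadd_left_commute

lemma vadd_zero [simp]:
  "length p = n \<Longrightarrow> p \<boxplus> replicate n 0 = p" "length p = n \<Longrightarrow> replicate n 0 \<boxplus> p = p"
  by (auto intro!: nth_equalityI)

lemma vadd_vneg_cancel:
  assumes "length p = length q"
  shows "p \<boxplus> (vneg p \<boxplus> q) = q" "vneg p \<boxplus> (p \<boxplus> q) = q"
  using assms by (auto intro!: nth_equalityI)

lemma vadd_left_cancel:
  assumes "length p = length q" "length q = length r"
  shows "p \<boxplus> q = p \<boxplus> r \<longleftrightarrow> q = r"
  using assms vadd_vneg_cancel(2) by metis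

text \<open>
  The integer coordinates \<open>w\<close> describe a point of the lattice \<open>(1/d) \<int>\<^sup>n\<close> relative to the
  generators of the cone with parameter \<open>N\<close>; the same lattice is obtained for every \<open>N\<close>
  because the shear is unimodular. Working with these coordinates keeps all computations with
  exponents in the integers.
\<close>

definition lattice_pt :: "nat \<Rightarrow> nat \<Rightarrow> nat \<Rightarrow> (nat \<Rightarrow> int) \<Rightarrow> rat list" where
  "lattice_pt n d N w = map (\<lambda>k. of_int (shear N w k) / of_nat d) [0..<n]"

definition lattice_cone :: "nat \<Rightarrow> nat \<Rightarrow> nat \<Rightarrow> rat list set" where
  "lattice_cone n d N = {lattice_pt n d N w | w. \<forall>k<n. 0 \<le> w k}"

lemma length_lattice_pt [simp]: "length (lattice_pt n d N w) = n"
  by (simp add: lattice_pt_def)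

lemma nth_lattice_pt [simp]: "k < n \<Longrightarrow> lattice_pt n d N w ! k = of_int (shear N w k) / of_nat d"
  by (simp add: lattice_pt_def)

lemma lattice_pt_add:
  "lattice_pt n d N u \<boxplus> lattice_pt n d N v = lattice_pt n d N (\<lambda>k. u k + v k)"
  by (rule nth_equalityI) (auto simp: shear_add add_divide_distrib)

lemma lattice_pt_inj:
  assumes "lattice_pt n d N u = lattice_pt n d N v" "d > 0" "k < n"
  shows "u k = v k"
proof (rule shear_determines)
  fix l assume l: "l < n"
  have "lattice_pt n d N u ! l = lattice_pt n d N v ! l" using assms(1) by simp
  then show "shear N u l = shear N v l" using l assms(2) by simp
qed fact

lemma lattice_pt_exists:
  assumes "length q = n" "\<And>k. k < n \<Longrightarrow> \<exists>z::int. q ! k = of_int z / of_nat d"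
  shows "\<exists>w. q = lattice_pt n d N w"
proof -
  obtain z where z: "\<And>k. k < n \<Longrightarrow> q ! k = of_int (z k) / of_nat d"
    using assms(2) by metis
  have "q = lattice_pt n d N (unshear N z)"
    using assms(1) z by (auto intro!: nth_equalityI)
  then show ?thesis by blast
qed

lemma lattice_coneI:
  assumes "\<And>k. k < n \<Longrightarrow> 0 \<le> w k" "\<And>k. k < n \<Longrightarrow> shear N' w k \<le> shear N u k"
  shows "lattice_pt n d N u \<in> lattice_cone n d N'"
proof -
  let ?w = "unshear N' (shear N u)"
  have "w k \<le> ?w k" if "k < n" for k
    using unshear_ge[where n = n] assms(2) that by blast
  then have "\<forall>k<n. 0 \<le> ?w k" using assms(1) by force
  moreover have "lattice_pt n d N u = lattice_pt n d N' ?w"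
    by (simp add: lattice_pt_def)
  ultimately show ?thesis unfolding lattice_cone_def by blast
qed

lemma length_lattice_cone: "g \<in> lattice_cone n d N \<Longrightarrow> length g = n"
  by (auto simp: lattice_cone_def)

lemma zero_lattice_cone [simp]: "replicate n 0 \<in> lattice_cone n d N"
proof -
  have "replicate n 0 = lattice_pt n d N (\<lambda>k. 0)"
    by (auto intro!: nth_equalityI simp: shear_def)
  then show ?thesis unfolding lattice_cone_def by auto
qed

lemma lattice_cone_add:
  assumes "g \<in> lattice_cone n d N" "h \<in> lattice_cone n d N"
  shows "g \<boxplus> h \<in> lattice_cone n d N"
proof -
  obtain u v where uv: "g = lattice_pt n d N u" "h = lattice_pt n d N v"
    "\<forall>k<n. 0 \<le> u k" "\<forall>k<n. 0 \<le> v k"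
    using assms by (auto simp: lattice_cone_def)
  then have "\<forall>k<n. 0 \<le> u k + v k" by (simp add: add_nonneg_nonneg)
  then show ?thesis using uv(1,2) lattice_pt_add unfolding lattice_cone_def by blast
qed

lemma lattice_cone_mono:
  assumes "N \<le> N'"
  shows "lattice_cone n d N \<subseteq> lattice_cone n d N'"
proof
  fix g assume "g \<in> lattice_cone n d N"
  then obtain w where w: "g = lattice_pt n d N w" "\<And>k. k < n \<Longrightarrow> 0 \<le> w k"
    by (auto simp: lattice_cone_def)
  have "shear N' w k \<le> shear N w k" if "k < n" for k
  proof -
    have "0 \<le> (\<Sum>l<k. w l)" using w(2) that by (intro sum_nonneg) auto
    then show ?thesis using assms by (simp add: shear_def mult_right_mono)
  qed
  with w show "g \<in> lattice_cone n d N'" by (metis lattice_coneI)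
qed

lemma lattice_cone_refine:
  assumes "d dvd d'" "d' > 0"
  shows "lattice_cone n d N \<subseteq> lattice_cone n d' N"
proof
  obtain e where e: "d' = d * e" using assms by auto
  have pos: "d > 0" "e > 0" using e assms by auto
  fix g assume "g \<in> lattice_cone n d N"
  then obtain w where w: "g = lattice_pt n d N w" "\<And>k. k < n \<Longrightarrow> 0 \<le> w k"
    by (auto simp: lattice_cone_def)
  have "g = lattice_pt n d' N (\<lambda>k. int e * w k)"
    unfolding w(1) using pos by (intro nth_equalityI) (auto simp: e shear_scale)
  then show "g \<in> lattice_cone n d' N" using w(2) unfolding lattice_cone_def by auto
qed

lemma lattice_cone_pointed:
  assumes "g \<in> lattice_cone n d N" "h \<in> lattice_cone n d N" "g \<boxplus> h = replicate n 0" "d > 0"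
  shows "g = replicate n 0" "h = replicate n 0"
proof -
  obtain u v where uv: "g = lattice_pt n d N u" "h = lattice_pt n d N v"
    "\<And>k. k < n \<Longrightarrow> 0 \<le> u k" "\<And>k. k < n \<Longrightarrow> 0 \<le> v k"
    using assms by (auto simp: lattice_cone_def)
  have zero: "replicate n 0 = lattice_pt n d N (\<lambda>k. 0)"
    by (auto intro!: nth_equalityI simp: shear_def)
  have "u k + v k = 0" if "k < n" for k
    using lattice_pt_inj[OF _ \<open>d > 0\<close> that] assms(3) uv(1,2) zero lattice_pt_add by metis
  then have "u k = 0" "v k = 0" if "k < n" for k
    using uv(3,4) that by (metis add_nonneg_eq_0_iff)+
  then have "shear N u k = 0" "shear N v k = 0" if "k < n" for k
    using that by (auto simp: shear_def)
  then show "g = replicate n 0" "h = replicate n 0"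
    by (auto simp: uv intro!: nth_equalityI)
qed

text \<open>
  In coordinates bounded below by \<open>-M\<close>, a lexicographically nonnegative lattice vector lies in a
  cone that depends on \<open>M\<close> only. The absolute values of the coordinates \<open>w\<close> serve as
  coordinates for the lower bound in the larger cone: where \<open>w\<^sub>k\<close> is negative, passing to
  \<open>\<bar>w\<^sub>k\<bar>\<close> costs at most \<open>2 M\<close>, and this is paid for by an earlier nonzero coordinate, which has
  absolute value at least 1 by integrality.
\<close>

lemma bounded_below_in_lattice_cone:
  assumes "\<And>k. k < n \<Longrightarrow> - int M \<le> w k"
    and "\<And>k. k < n \<Longrightarrow> w k < 0 \<Longrightarrow> \<exists>l<k. w l \<noteq> 0"
  shows "lattice_pt n d N w \<in> lattice_cone n d (N + 2 * M)"
proof (rule lattice_coneI[where w = "\<lambda>k. \<bar>w k\<bar>"])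
  fix k assume k: "k < n"
  have le: "(\<Sum>l<k. w l) \<le> (\<Sum>l<k. \<bar>w l\<bar>)" by (intro sum_mono) auto
  have N: "int N * (\<Sum>l<k. w l) \<le> int N * (\<Sum>l<k. \<bar>w l\<bar>)"
    using le by (intro mult_left_mono) auto
  have nn: "0 \<le> int M * (\<Sum>l<k. \<bar>w l\<bar>)" by (simp add: sum_nonneg)
  have "\<bar>w k\<bar> - w k \<le> 2 * (int M * (\<Sum>l<k. \<bar>w l\<bar>))"
  proof (cases "w k < 0")
    case True
    then obtain l where l: "l < k" "w l \<noteq> 0" using assms(2) k by blast
    have "\<bar>w l\<bar> \<le> (\<Sum>l<k. \<bar>w l\<bar>)" using l by (intro member_le_sum) auto
    then have "1 \<le> (\<Sum>l<k. \<bar>w l\<bar>)" using l by linarith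
    then have "int M * 1 \<le> int M * (\<Sum>l<k. \<bar>w l\<bar>)" by (intro mult_left_mono) auto
    with assms(1)[OF k] True show ?thesis by linarith
  qed (use nn in simp)
  with N show "shear (N + 2 * M) (\<lambda>k. \<bar>w k\<bar>) k \<le> shear N w k"
    by (simp add: shear_def algebra_simps)
qed simp


section \<open>Least exponents\<close>

text \<open>
  The lexicographically least element: the coordinates are minimised one after the other, each
  among the elements that minimise the previous ones.
\<close>

lemma lexicographic_minimum:
  fixes S :: "(nat \<Rightarrow> int) set"
  assumes "S \<noteq> {}" "\<And>u k. u \<in> S \<Longrightarrow> k < n \<Longrightarrow> 0 \<le> u k"
  shows "\<exists>m\<in>S. \<forall>u\<in>S. \<forall>k<n. (\<forall>l<k. u l = m l) \<longrightarrow> m k \<le> u k"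
  using assms(2)
proof (induction n)
  case 0
  then show ?case using assms(1) by auto
next
  case (Suc n)
  then obtain m where m: "m \<in> S" "\<And>u k. u \<in> S \<Longrightarrow> k < n \<Longrightarrow> (\<forall>l<k. u l = m l) \<Longrightarrow> m k \<le> u k"
    by (metis less_SucI)
  define S' where "S' = {u \<in> S. \<forall>l<n. u l = m l}"
  have "m \<in> S'" using m by (simp add: S'_def)
  then obtain m' where m': "m' \<in> S'" "\<And>u. u \<in> S' \<Longrightarrow> nat (m' n) \<le> nat (u n)"
    using ex_has_least_nat[of "\<lambda>u. u \<in> S'" m "\<lambda>u. nat (u n)"] by blast
  show ?case
  proof (intro bexI ballI allI impI)
    show "m' \<in> S" using m' by (simp add: S'_def)
    fix u k assume u: "u \<in> S" and k: "k < Suc n" and eq: "\<forall>l<k. u l = m' l"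
    show "m' k \<le> u k"
    proof (cases "k = n")
      case True
      then have "u \<in> S'" using u eq m' by (auto simp: S'_def)
      then have "nat (m' n) \<le> nat (u n)" by (rule m')
      then show ?thesis using True Suc.prems[of u n] u by simp
    next
      case False
      then show ?thesis using m(2)[OF u, of k] k eq m'(1) by (auto simp: S'_def)
    qed
  qed
qed

text \<open>
  A set of exponents in a translated cone has a lexicographically least element \<open>m\<close>. The
  coordinates of the differences to \<open>m\<close> are bounded below by minus those of \<open>m\<close>, so a single
  larger cone contains all the differences.
\<close>

lemma least_exponent:
  assumes S: "S \<noteq> {}" "S \<subseteq> (\<boxplus>) e ` lattice_cone n d N"
  shows "\<exists>m\<in>S. \<exists>N'\<ge>N. S \<subseteq> (\<boxplus>) m ` lattice_cone n d N'"
proof -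
  define U where "U = {u. (\<forall>k<n. 0 \<le> u k) \<and> e \<boxplus> lattice_pt n d N u \<in> S}"
  have U: "\<exists>u\<in>U. q = e \<boxplus> lattice_pt n d N u" if "q \<in> S" for q
  proof -
    obtain u where "q = e \<boxplus> lattice_pt n d N u" "\<forall>k<n. 0 \<le> u k"
      using S(2) \<open>q \<in> S\<close> by (auto simp: lattice_cone_def)
    with \<open>q \<in> S\<close> show ?thesis by (auto simp: U_def)
  qed
  then have "U \<noteq> {}" using S(1) by blast
  then obtain m where m: "m \<in> U" "\<And>u k. u \<in> U \<Longrightarrow> k < n \<Longrightarrow> (\<forall>l<k. u l = m l) \<Longrightarrow> m k \<le> u k"
    using lexicographic_minimum[of U n] unfolding U_def by blast
  define M where "M = nat (\<Sum>k<n. m k)"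
  have M: "m k \<le> int M" if "k < n" for k
  proof -
    have "m k \<le> (\<Sum>k<n. m k)" using m(1) that by (intro member_le_sum) (auto simp: U_def)
    then show ?thesis by (simp add: M_def)
  qed
  have cone: "lattice_pt n d N (\<lambda>k. u k - m k) \<in> lattice_cone n d (N + 2 * M)"
    if "u \<in> U" for u
  proof (rule bounded_below_in_lattice_cone)
    fix k assume k: "k < n"
    show "- int M \<le> u k - m k" using M[OF k] k that by (force simp: U_def)
    assume "u k - m k < 0"
    then show "\<exists>l<k. u l - m l \<noteq> 0" using m(2)[OF that k] by force
  qed
  have "S \<subseteq> (\<boxplus>) (e \<boxplus> lattice_pt n d N m) ` lattice_cone n d (N + 2 * M)"
  proof
    fix q assume "q \<in> S"
    then obtain u where u: "u \<in> U" "q = e \<boxplus> lattice_pt n d N u" using U by blast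
    have "q = e \<boxplus> lattice_pt n d N m \<boxplus> lattice_pt n d N (\<lambda>k. u k - m k)"
      by (simp add: vadd_assoc lattice_pt_add u(2))
    with cone[OF u(1)] show "q \<in> (\<boxplus>) (e \<boxplus> lattice_pt n d N m) ` lattice_cone n d (N + 2 * M)"
      by blast
  qed
  moreover have "e \<boxplus> lattice_pt n d N m \<in> S" using m(1) by (simp add: U_def)
  ultimately show ?thesis by (meson le_add1)
qed

text \<open>
  Either a lattice vector or its negative is lexicographically nonnegative, and a single vector is
  trivially bounded below.
\<close>

lemma lattice_cone_total:
  assumes "length q = n" "\<And>k. k < n \<Longrightarrow> \<exists>z::int. q ! k = of_int z / of_nat d"
  shows "\<exists>N. q \<in> lattice_cone n d N \<or> vneg q \<in> lattice_cone n d N"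
proof -
  obtain w where w: "q = lattice_pt n d 0 w" using lattice_pt_exists[OF assms] by blast
  have neg: "vneg q = lattice_pt n d 0 (\<lambda>k. - w k)"
    by (auto simp: w shear_def intro!: nth_equalityI)
  define M where "M = nat (\<Sum>k<n. \<bar>w k\<bar>)"
  have M: "\<bar>w k\<bar> \<le> int M" if "k < n" for k
  proof -
    have "\<bar>w k\<bar> \<le> (\<Sum>k<n. \<bar>w k\<bar>)" using that by (intro member_le_sum) auto
    then show ?thesis by (simp add: M_def)
  qed
  show ?thesis
  proof (cases "\<forall>k<n. w k < 0 \<longrightarrow> (\<exists>l<k. w l \<noteq> 0)")
    case True
    have "q \<in> lattice_cone n d (0 + 2 * M)" unfolding w
    proof (rule bounded_below_in_lattice_cone)
      fix k assume "k < n"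
      then show "- int M \<le> w k" using M[of k] by simp
    qed (use True in blast)
    then show ?thesis by blast
  next
    case False
    then obtain k where k: "w k < 0" "\<forall>l<k. w l = 0" by auto
    have "vneg q \<in> lattice_cone n d (0 + 2 * M)" unfolding neg
    proof (rule bounded_below_in_lattice_cone)
      fix j assume "j < n"
      then show "- int M \<le> - w j" using M[of j] by simp
      assume "- w j < 0"
      then have "\<not> j \<le> k" using k by (cases "j = k") auto
      then show "\<exists>l<j. - w l \<noteq> 0" using k(1) by (intro exI[of _ k]) auto
    qed
    then show ?thesis by blast
  qed
qed


section \<open>Series supported in a shifted cone\<close>

text \<open>
  \<open>rooted n d N e f\<close> expresses that \<open>f\<close> is the monomial \<open>x\<^sup>e\<close> times a series with exponents
  in the cone. The coefficient at \<open>e\<close> may vanish.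
\<close>

definition rooted :: "nat \<Rightarrow> nat \<Rightarrow> nat \<Rightarrow> rat list \<Rightarrow> (rat list \<Rightarrow> 'k::field) \<Rightarrow> bool" where
  "rooted n d N e f \<longleftrightarrow> {q. f q \<noteq> 0} \<subseteq> (\<boxplus>) e ` lattice_cone n d N"

lemma rootedD: "rooted n d N e f \<Longrightarrow> f q \<noteq> 0 \<Longrightarrow> \<exists>g\<in>lattice_cone n d N. q = e \<boxplus> g"
  by (auto simp: rooted_def)

lemma rooted_mono:
  assumes "rooted n d N e f" "d dvd d'" "d' > 0" "N \<le> N'"
  shows "rooted n d' N' e f"
  using assms lattice_cone_mono[of N N' n d'] lattice_cone_refine[of d d' n N]
  unfolding rooted_def by blast

definition is_exponent :: "nat \<Rightarrow> nat \<Rightarrow> rat list \<Rightarrow> bool" where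
  "is_exponent n d q \<longleftrightarrow> length q = n \<and> (\<forall>k<n. \<exists>z::int. q ! k = of_int z / of_nat d)"

lemma is_exponent_lattice_pt: "is_exponent n d (lattice_pt n d N w)"
  by (auto simp: is_exponent_def)

lemma is_exponent_obtain:
  assumes "is_exponent n d q"
  obtains w where "q = lattice_pt n d N w"
  using lattice_pt_exists[of q n d N] assms unfolding is_exponent_def by blast

lemma is_exponent_add:
  assumes "is_exponent n d p" "is_exponent n d q"
  shows "is_exponent n d (p \<boxplus> q)"
proof -
  obtain u where u: "p = lattice_pt n d 0 u" using is_exponent_obtain[OF assms(1)] .
  obtain v where v: "q = lattice_pt n d 0 v" using is_exponent_obtain[OF assms(2)] .
  show ?thesis unfolding u v lattice_pt_add by (rule is_exponent_lattice_pt)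
qed

lemma is_exponent_neg:
  assumes "is_exponent n d p"
  shows "is_exponent n d (vneg p)"
proof -
  obtain u where u: "p = lattice_pt n d 0 u" using is_exponent_obtain[OF assms(1)] .
  have "vneg p = lattice_pt n d 0 (\<lambda>k. - u k)"
    by (rule nth_equalityI) (simp_all add: u shear_def)
  then show ?thesis using is_exponent_lattice_pt by simp
qed

lemma is_exponent_lattice_cone: "g \<in> lattice_cone n d N \<Longrightarrow> is_exponent n d g"
  by (auto simp: lattice_cone_def is_exponent_lattice_pt)

lemma is_exponent_zero: "is_exponent n d (replicate n 0)"
  using is_exponent_lattice_cone[OF zero_lattice_cone] .

lemma iter_laurent_is_exponent:
  "f \<in> iter_laurent n d \<Longrightarrow> f q \<noteq> 0 \<Longrightarrow> is_exponent n d q"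
proof (induction n arbitrary: f q)
  case 0
  then show ?case by (auto simp: is_exponent_def)
next
  case (Suc n)
  then obtain p q' where q: "q = p # q'" by (cases q) auto
  have "is_exponent n d q'" using Suc q by (intro Suc.IH[of "\<lambda>q. f (p # q)"]) auto
  moreover have "(\<lambda>q. f (p # q)) \<noteq> (\<lambda>_. 0)" using Suc.prems q by metis
  then have "\<exists>m::int. p = of_int m / of_nat d" using Suc.prems(1) by fastforce
  ultimately show ?case by (auto simp: is_exponent_def q nth_Cons split: nat.split)
qed

text \<open>
  The recursive condition on iterated Laurent series, unfolded: among the exponents that share the
  first \<open>k\<close> entries, the next entry is bounded below.
\<close>

lemma iter_laurentI:
  assumes "d > 0" "\<And>q. f q \<noteq> 0 \<Longrightarrow> is_exponent n d q"
    and "\<And>q k. f q \<noteq> 0 \<Longrightarrow> k < n \<Longrightarrow>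
      \<exists>B. \<forall>q'. f q' \<noteq> 0 \<longrightarrow> take k q' = take k q \<longrightarrow> B \<le> q' ! k"
  shows "f \<in> iter_laurent n d"
  using assms(2,3)
proof (induction n arbitrary: f)
  case 0
  then show ?case by (force simp: is_exponent_def)
next
  case (Suc n)
  have "(\<lambda>q. f (p # q)) \<in> iter_laurent n d" for p
  proof (rule Suc.IH)
    fix q assume q: "f (p # q) \<noteq> 0"
    show "is_exponent n d q" using Suc.prems(1)[OF q] by (force simp: is_exponent_def)
    fix k assume "k < n"
    then obtain B where "\<forall>q'. f q' \<noteq> 0 \<longrightarrow> take (Suc k) q' = take (Suc k) (p # q) \<longrightarrow> B \<le> q' ! Suc k"
      using Suc.prems(2)[OF q, of "Suc k"] by auto
    from spec[OF this, of "p # _"]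
    show "\<exists>B. \<forall>q'. f (p # q') \<noteq> 0 \<longrightarrow> take k q' = take k q \<longrightarrow> B \<le> q' ! k" by auto
  qed
  moreover have "\<exists>N::int. \<forall>p. (\<lambda>q. f (p # q)) \<noteq> (\<lambda>_. 0) \<longrightarrow>
      p \<in> {of_int m / of_nat d | m. m \<ge> N}"
  proof (cases "\<exists>q. f q \<noteq> 0")
    case True
    then obtain B where B: "\<And>q. f q \<noteq> 0 \<Longrightarrow> B \<le> q ! 0" using Suc.prems(2)[of _ 0] by auto
    have "\<exists>m\<ge>\<lfloor>B * of_nat d\<rfloor>. p = of_int m / of_nat d" if p: "(\<lambda>q. f (p # q)) \<noteq> (\<lambda>_. 0)" for p
    proof -
      obtain q where q: "f (p # q) \<noteq> 0" using p by auto
      obtain m :: int where m: "p = of_int m / of_nat d"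
        using Suc.prems(1)[OF q] by (force simp: is_exponent_def)
      have "B * of_nat d \<le> of_int m" using B[OF q] m assms(1) by (simp add: field_simps)
      then have "\<lfloor>B * of_nat d\<rfloor> \<le> m" by (simp add: floor_le_iff)
      with m show ?thesis by blast
    qed
    then show ?thesis by blast
  qed (auto simp: fun_eq_iff)
  moreover have "f [] = 0" using Suc.prems(1)[of "[]"] by (auto simp: is_exponent_def)
  ultimately show ?case by simp
qed

text \<open>
  The first \<open>k\<close> entries of a point of the cone determine its first \<open>k\<close> coordinates, and hence
  what the shear subtracts from the next coordinate, which is nonnegative.
\<close>

lemma rooted_iter_laurent:
  assumes f: "rooted n d N e f" and e: "is_exponent n d e" and d: "d > 0"
  shows "f \<in> iter_laurent n d"
proof (rule iter_laurentI[OF d])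
  fix q assume q: "f q \<noteq> 0"
  show "is_exponent n d q"
    using rootedD[OF f q] is_exponent_add[OF e is_exponent_lattice_cone] by blast
  have len: "length e = n" using e by (simp add: is_exponent_def)
  obtain u where u: "q = e \<boxplus> lattice_pt n d N u"
    using rootedD[OF f q] by (auto simp: lattice_cone_def)
  fix k assume k: "k < n"
  have "e ! k - of_int (int N * (\<Sum>l<k. u l)) / of_nat d \<le> q' ! k"
    if q': "f q' \<noteq> 0" and eq: "take k q' = take k q" for q'
  proof -
    obtain u' where u': "q' = e \<boxplus> lattice_pt n d N u'" "\<And>k. k < n \<Longrightarrow> 0 \<le> u' k"
      using rootedD[OF f q'] by (auto simp: lattice_cone_def)
    have "shear N u' l = shear N u l" if l: "l < k" for l
    proof -
      have "q' ! l = q ! l" using eq l by (metis nth_take)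
      then show ?thesis using l k d by (simp add: u u' len)
    qed
    then have "u' l = u l" if "l < k" for l using shear_determines that by blast
    then have "(\<Sum>l<k. u' l) = (\<Sum>l<k. u l)" by (intro sum.cong) auto
    then have "q' ! k = e ! k + of_int (u' k - int N * (\<Sum>l<k. u l)) / of_nat d"
      using k by (simp add: u' len shear_def)
    moreover have "0 \<le> rat_of_int (u' k) / of_nat d" using u'(2)[OF k] by simp
    ultimately show ?thesis by (simp add: diff_divide_distrib)
  qed
  then show "\<exists>B. \<forall>q'. f q' \<noteq> 0 \<longrightarrow> take k q' = take k q \<longrightarrow> B \<le> q' ! k" by blast
qed

lemma rooted_zero_iff:
  "rooted n d N (replicate n 0) f \<longleftrightarrow> {q. f q \<noteq> 0} \<subseteq> lattice_cone n d N"
proof -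
  have "(\<boxplus>) (replicate n 0) ` lattice_cone n d N = lattice_cone n d N"
    by (simp add: length_lattice_cone cong: image_cong)
  then show ?thesis by (simp add: rooted_def)
qed

text \<open>
  Cofinality of the sheared orthants gives one direction. The coordinates found there are real
  numbers; they agree with the integral coordinates of the exponent, up to the factor \<open>d\<close>,
  because a shear is injective.
\<close>

lemma star_series_iff:
  "f \<in> star_series n \<longleftrightarrow> (\<exists>d>0. \<exists>N. rooted n d N (replicate n 0) f)"
proof
  assume "f \<in> star_series n"
  then obtain \<Gamma> d where \<Gamma>: "\<Gamma> \<in> cones n" "d > 0" "f \<in> iter_laurent n d" "newton f \<subseteq> \<Gamma>"
    unfolding star_series_def cone_series_def by blast
  obtain N where N: "\<Gamma> \<subseteq> real_cone n N" using cone_subset_real_cone[OF \<Gamma>(1)] by blast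
  have "q \<in> lattice_cone n d N" if q: "f q \<noteq> 0" for q
  proof -
    have exp: "is_exponent n d q" using iter_laurent_is_exponent \<Gamma>(3) q by blast
    then obtain w where w: "q = lattice_pt n d N w" by (rule is_exponent_obtain)
    have "map of_rat q \<in> real_cone n N" using \<Gamma>(4) N q by (auto simp: newton_def)
    then obtain u where "\<forall>k<n. 0 \<le> u k \<and> map real_of_rat q ! k = shear N u k"
      unfolding real_cone_def mem_Collect_eq by (elim conjE exE)
    then have u: "\<And>k. k < n \<Longrightarrow> 0 \<le> u k" "\<And>k. k < n \<Longrightarrow> map real_of_rat q ! k = shear N u k"
      by simp_all
    have "shear N (\<lambda>k. real_of_int (w k)) k = shear N (\<lambda>k. real d * u k) k" if "k < n" for k
      using u(2)[OF that] that \<Gamma>(2)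
      by (simp add: w shear_scale shear_of_int of_rat_divide field_simps)
    then have "real_of_int (w k) = real d * u k" if "k < n" for k
      using shear_determines[of n] that by blast
    then have "0 \<le> w k" if "k < n" for k using u(1)[OF that] that
      by (metis mult_nonneg_nonneg of_int_0_le_iff of_nat_0_le_iff)
    then show ?thesis using w by (auto simp: lattice_cone_def)
  qed
  then show "\<exists>d>0. \<exists>N. rooted n d N (replicate n 0) f"
    using \<Gamma>(2) by (auto simp: rooted_zero_iff)
next
  assume "\<exists>d>0. \<exists>N. rooted n d N (replicate n 0) f"
  then obtain d N where d: "d > 0" and f: "rooted n d N (replicate n 0) f" by blast
  obtain \<Phi> where \<Phi>: "\<Phi> \<in> blow_down_comps n"
    "\<And>a. a \<in> Rn n \<Longrightarrow> \<Phi> a = map (shear N (\<lambda>k. a ! k)) [0..<n]"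
    using shear_in_blow_down_comps by blast
  have "newton f \<subseteq> \<Phi> ` orthant n"
  proof
    fix v assume "v \<in> newton f"
    then obtain q where q: "v = map of_rat q" "f q \<noteq> 0" by (auto simp: newton_def)
    then obtain w where w: "q = lattice_pt n d N w" "\<And>k. k < n \<Longrightarrow> 0 \<le> w k"
      using f by (auto simp: rooted_zero_iff lattice_cone_def)
    define a where "a = map (\<lambda>k. inverse (real d) * real_of_int (w k)) [0..<n]"
    have "shear N (\<lambda>k. a ! k) k = inverse (real d) * real_of_int (shear N w k)" if "k < n" for k
    proof -
      have "shear N (\<lambda>k. a ! k) k = shear N (\<lambda>k. inverse (real d) * real_of_int (w k)) k"
        using that by (simp add: shear_def a_def)
      then show ?thesis by (simp only: shear_scale shear_of_int)
    qed
    then have "v = map (shear N (\<lambda>k. a ! k)) [0..<n]"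
      by (auto simp: q(1) w(1) of_rat_divide field_simps intro!: nth_equalityI)
    also have "\<dots> = \<Phi> a" by (simp add: \<Phi>(2) Rn_def a_def)
    finally show "v \<in> \<Phi> ` orthant n" using w(2)
      by (auto simp: orthant_def Rn_def a_def)
  qed
  moreover have "f \<in> iter_laurent n d" using rooted_iter_laurent[OF f is_exponent_zero d] .
  ultimately show "f \<in> star_series n"
    using d \<Phi>(1) unfolding star_series_def cone_series_def cones_def by blast
qed


section \<open>Convolution\<close>

definition splits :: "(rat list \<Rightarrow> 'k::field) \<Rightarrow> (rat list \<Rightarrow> 'k) \<Rightarrow> rat list \<Rightarrow> (rat list \<times> rat list) set" where
  "splits f g a = {(b, c). f b \<noteq> 0 \<and> g c \<noteq> 0 \<and> b \<boxplus> c = a}"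

definition conv :: "(rat list \<Rightarrow> 'k::field) \<Rightarrow> (rat list \<Rightarrow> 'k) \<Rightarrow> rat list \<Rightarrow> 'k" where
  "conv f g a = (\<Sum>(b, c)\<in>splits f g a. f b * g c)"

lemma series_ring_simps [simp]:
  "f \<otimes>\<^bsub>series_ring n\<^esub> g = conv f g"
  "\<one>\<^bsub>series_ring n\<^esub> = (\<lambda>a. if a = replicate n 0 then 1 else 0)"
  "\<zero>\<^bsub>series_ring n\<^esub> = (\<lambda>a. 0)"
  "f \<oplus>\<^bsub>series_ring n\<^esub> g = (\<lambda>a. f a + g a)"
  by (simp_all add: series_ring_def conv_def splits_def vadd_def fun_eq_iff)

lemma carrier_series_ring:
  "f \<in> carrier (series_ring n) \<longleftrightarrow> (\<exists>d>0. f \<in> iter_laurent n d)"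
  by (auto simp: series_ring_def)

lemma finite_splits:
  "f \<in> carrier (series_ring n) \<Longrightarrow> g \<in> carrier (series_ring n) \<Longrightarrow> finite (splits f g a)"
  unfolding splits_def vadd_def by (rule finite_convolution)

lemma conv_eq_sum:
  assumes "finite I" "splits f g a \<subseteq> I" "\<And>b c. (b, c) \<in> I \<Longrightarrow> b \<boxplus> c = a"
  shows "conv f g a = (\<Sum>(b, c)\<in>I. f b * g c)"
  unfolding conv_def using assms
  by (intro sum.mono_neutral_left) (auto simp: splits_def)

lemma conv_nonzeroE:
  assumes "conv f g a \<noteq> 0"
  obtains b c where "f b \<noteq> 0" "g c \<noteq> 0" "a = b \<boxplus> c"
proof -
  have "splits f g a \<noteq> {}" using assms by (metis conv_def sum.empty)
  then show thesis using that by (auto simp: splits_def)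
qed

lemma conv_commute: "conv f g = conv g f"
proof
  fix a
  show "conv f g a = conv g f a" unfolding conv_def
    by (rule sum.reindex_bij_witness[of _ prod.swap prod.swap])
      (auto simp: splits_def vadd_commute mult.commute)
qed

definition triples ::
  "(rat list \<Rightarrow> 'k::field) \<Rightarrow> (rat list \<Rightarrow> 'k) \<Rightarrow> (rat list \<Rightarrow> 'k) \<Rightarrow> rat list
    \<Rightarrow> (rat list \<times> rat list \<times> rat list) set" where
  "triples f g h a = {(p, q, r). f p \<noteq> 0 \<and> g q \<noteq> 0 \<and> h r \<noteq> 0 \<and> p \<boxplus> q \<boxplus> r = a}"

text \<open>
  The product of three series is a sum over triples of exponents, grouped here by the sum of the
  first two. A group may have a vanishing total, so the outer sum is first enlarged to run over
  all sums of exponents that occur.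
\<close>

lemma conv_conv:
  assumes "finite (triples f g h a)"
  shows "conv (conv f g) h a = (\<Sum>(p, q, r)\<in>triples f g h a. f p * g q * h r)"
proof -
  let ?T = "triples f g h a" and ?F = "\<lambda>(p, q, r). f p * g q * h r"
  define \<phi> where "\<phi> = (\<lambda>(p, q, r :: rat list). (p \<boxplus> q, r))"
  have "conv (conv f g) h a = (\<Sum>(s, r)\<in>\<phi> ` ?T. conv f g s * h r)"
  proof (rule conv_eq_sum)
    show "splits (conv f g) h a \<subseteq> \<phi> ` ?T"
    proof
      fix z assume "z \<in> splits (conv f g) h a"
      then obtain s r where z: "z = (s, r)" "conv f g s \<noteq> 0" "h r \<noteq> 0" "s \<boxplus> r = a"
        by (auto simp: splits_def)
      obtain p q where "f p \<noteq> 0" "g q \<noteq> 0" "s = p \<boxplus> q" using z(2) by (rule conv_nonzeroE)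
      with z have "(p, q, r) \<in> ?T" "z = \<phi> (p, q, r)" by (auto simp: triples_def \<phi>_def)
      then show "z \<in> \<phi> ` ?T" by blast
    qed
  qed (use assms in \<open>auto simp: triples_def \<phi>_def\<close>)
  also have "\<dots> = (\<Sum>y\<in>\<phi> ` ?T. sum ?F {x \<in> ?T. \<phi> x = y})"
  proof (rule sum.cong[OF refl])
    fix y assume "y \<in> \<phi> ` ?T"
    then obtain s r where y: "y = (s, r)" "h r \<noteq> 0" "s \<boxplus> r = a"
      by (auto simp: triples_def \<phi>_def)
    have "conv f g s * h r = (\<Sum>(p, q)\<in>splits f g s. f p * g q * h r)"
      by (simp add: conv_def sum_distrib_right case_prod_unfold)
    also have "\<dots> = sum ?F {x \<in> ?T. \<phi> x = y}"
      by (rule sum.reindex_bij_witness[of _ "\<lambda>(p, q, r). (p, q)" "\<lambda>(p, q). (p, q, r)"])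
        (use y in \<open>auto simp: splits_def triples_def \<phi>_def\<close>)
    finally show "(case y of (s, r) \<Rightarrow> conv f g s * h r) = sum ?F {x \<in> ?T. \<phi> x = y}"
      by (simp add: y)
  qed
  also have "\<dots> = sum ?F ?T" by (rule sum.image_gen[OF assms, symmetric])
  finally show ?thesis .
qed

text \<open>
  By commutativity both sides are iterated products bracketed to the left, in opposite orders.
\<close>

lemma conv_assoc:
  assumes "\<And>a. finite (triples f g h a)"
  shows "conv (conv f g) h = conv f (conv g h)"
proof
  fix a
  have sub: "triples h g f a \<subseteq> (\<lambda>(p, q, r). (r, q, p)) ` triples f g h a"
  proof
    fix x assume "x \<in> triples h g f a"
    then obtain p q r where "x = (r, q, p)" "(p, q, r) \<in> triples f g h a"
      by (auto simp: triples_def vadd_ac)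
    then show "x \<in> (\<lambda>(p, q, r). (r, q, p)) ` triples f g h a" by force
  qed
  have fin: "finite (triples h g f a)"
    by (rule finite_subset[OF sub]) (simp add: assms)
  have "conv f (conv g h) a = conv (conv h g) f a" by (simp add: conv_commute)
  also have "\<dots> = (\<Sum>(r, q, p)\<in>triples h g f a. h r * g q * f p)" by (rule conv_conv[OF fin])
  also have "\<dots> = (\<Sum>(p, q, r)\<in>triples f g h a. f p * g q * h r)"
    by (rule sum.reindex_bij_witness[of _ "\<lambda>(p, q, r). (r, q, p)" "\<lambda>(p, q, r). (r, q, p)"])
      (auto simp: triples_def vadd_ac)
  also have "\<dots> = conv (conv f g) h a" by (rule conv_conv[OF assms, symmetric])
  finally show "conv (conv f g) h a = conv f (conv g h) a" by (rule sym)
qed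

lemma conv_one:
  assumes "f \<in> carrier (series_ring n)"
  shows "conv \<one>\<^bsub>series_ring n\<^esub> f = f"
proof
  fix a
  have len: "length c = n" if "f c \<noteq> 0" for c
    using assms that by (auto simp: carrier_series_ring dest: iter_laurent_length)
  show "conv \<one>\<^bsub>series_ring n\<^esub> f a = f a"
  proof (cases "f a = 0")
    case True
    then have "splits \<one>\<^bsub>series_ring n\<^esub> f a = {}"
      using len by (auto simp: splits_def split: if_splits)
    then show ?thesis using True by (simp add: conv_def del: series_ring_simps)
  next
    case False
    then have "splits \<one>\<^bsub>series_ring n\<^esub> f a = {(replicate n 0, a)}"
      using len by (auto simp: splits_def split: if_splits)
    then show ?thesis by (simp add: conv_def del: series_ring_simps) simp
  qed
qed

lemma rooted_conv:
  assumes "rooted n d N e f" "rooted n d N e' g"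
  shows "rooted n d N (e \<boxplus> e') (conv f g)"
  unfolding rooted_def
proof
  fix a assume "a \<in> {q. conv f g q \<noteq> 0}"
  then have "conv f g a \<noteq> 0" by simp
  then obtain b c where bc: "f b \<noteq> 0" "g c \<noteq> 0" "a = b \<boxplus> c" by (rule conv_nonzeroE)
  obtain u where u: "u \<in> lattice_cone n d N" "b = e \<boxplus> u"
    using rootedD[OF assms(1) bc(1)] by blast
  obtain v where v: "v \<in> lattice_cone n d N" "c = e' \<boxplus> v"
    using rootedD[OF assms(2) bc(2)] by blast
  have "a = e \<boxplus> e' \<boxplus> (u \<boxplus> v)" by (simp add: bc(3) u(2) v(2) vadd_ac)
  moreover have "u \<boxplus> v \<in> lattice_cone n d N" using u(1) v(1) by (rule lattice_cone_add)
  ultimately show "a \<in> (\<boxplus>) (e \<boxplus> e') ` lattice_cone n d N" by blast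
qed

text \<open>
  Since the cone contains no line, \<open>e + e'\<close> is the sum of an exponent of \<open>f\<close> and an exponent
  of \<open>g\<close> in one way at most.
\<close>

lemma conv_leading:
  assumes f: "rooted n d N e f" and g: "rooted n d N e' g"
    and len: "length e = n" "length e' = n" and d: "d > 0"
  shows "conv f g (e \<boxplus> e') = f e * g e'"
proof -
  have "b = e \<and> c = e'" if "(b, c) \<in> splits f g (e \<boxplus> e')" for b c
  proof -
    have bc: "f b \<noteq> 0" "g c \<noteq> 0" "b \<boxplus> c = e \<boxplus> e'" using that by (auto simp: splits_def)
    obtain u where u: "u \<in> lattice_cone n d N" "b = e \<boxplus> u"
      using rootedD[OF f bc(1)] by blast
    obtain v where v: "v \<in> lattice_cone n d N" "c = e' \<boxplus> v"
      using rootedD[OF g bc(2)] by blast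
    have "(e \<boxplus> e') \<boxplus> (u \<boxplus> v) = (e \<boxplus> e') \<boxplus> replicate n 0"
      using bc(3) len by (simp add: u(2) v(2) vadd_ac)
    then have "u \<boxplus> v = replicate n 0"
      using len u v by (subst (asm) vadd_left_cancel) (auto simp: length_lattice_cone)
    from lattice_cone_pointed[OF u(1) v(1) this d] show ?thesis using u v len by simp
  qed
  then have "conv f g (e \<boxplus> e') = (\<Sum>(b, c)\<in>{(e, e')}. f b * g c)"
    by (intro conv_eq_sum) auto
  then show ?thesis by simp
qed

lemma rooted_carrier:
  "rooted n d N e f \<Longrightarrow> is_exponent n d e \<Longrightarrow> d > 0 \<Longrightarrow> f \<in> carrier (series_ring n)"
  unfolding carrier_series_ring using rooted_iter_laurent by blast


section \<open>Inverses\<close>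

text \<open>
  The equation \<open>b * y = 1\<close> determines the coefficients of \<open>y\<close> recursively: in the coefficient
  of \<open>b * y\<close> at \<open>m + c\<^sub>0\<close>, the unknown \<open>y c\<^sub>0\<close> has the factor \<open>b m \<noteq> 0\<close>, and all other
  terms involve \<open>y\<close> at exponents \<open>c\<close> for which \<open>c\<^sub>0 - c\<close> is a nonzero element of the cone.
  The recursion is along the sum of the coordinates, which is positive on such differences.
\<close>

lemma rooted_right_inverse:
  fixes b :: "rat list \<Rightarrow> 'k::field"
  assumes b: "rooted n d N m b" "b m \<noteq> 0" and m: "is_exponent n d m" and d: "d > 0"
  shows "\<exists>y. rooted n d N (vneg m) y \<and> conv b y = \<one>\<^bsub>series_ring n\<^esub>"
proof -
  let ?G = "lattice_cone n d N"
  define C where "C = (\<boxplus>) (vneg m) ` ?G"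
  define \<delta> :: "rat list \<Rightarrow> 'k" where "\<delta> = \<one>\<^bsub>series_ring n\<^esub>"
  define I where "I c\<^sub>0 = {(p, c). b p \<noteq> 0 \<and> p \<noteq> m \<and> c \<in> C \<and> p \<boxplus> c = m \<boxplus> c\<^sub>0}" for c\<^sub>0
  \<comment> \<open>the coordinates of \<open>m + c\<close>, unspecified unless \<open>m + c\<close> is a lattice point\<close>
  define coord where "coord c = (SOME w. c = vneg m \<boxplus> lattice_pt n d N w)" for c
  define height where "height c = nat (\<Sum>k<n. coord c k)" for c
  have len: "length m = n" using m by (simp add: is_exponent_def)
  have cancel: "m \<boxplus> (vneg m \<boxplus> q) = q" "vneg m \<boxplus> (m \<boxplus> q) = q" if "length q = n" for q
    using vadd_vneg_cancel[of m q] len that by simp_all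
  have height: "height (vneg m \<boxplus> lattice_pt n d N w) = nat (\<Sum>k<n. w k)" for w
  proof -
    let ?v = "coord (vneg m \<boxplus> lattice_pt n d N w)"
    have "vneg m \<boxplus> lattice_pt n d N w = vneg m \<boxplus> lattice_pt n d N ?v"
      unfolding coord_def
      by (rule someI[where P = "\<lambda>v. vneg m \<boxplus> lattice_pt n d N w = vneg m \<boxplus> lattice_pt n d N v"])
        (rule refl)
    then have "lattice_pt n d N w = lattice_pt n d N ?v"
      by (subst (asm) vadd_left_cancel) (simp_all add: len)
    then have "(\<Sum>k<n. ?v k) = (\<Sum>k<n. w k)"
      using lattice_pt_inj[OF _ d] by (intro sum.cong) (auto simp: eq_commute)
    then show ?thesis by (simp add: height_def)
  qed
  have decreasing: "height c < height c\<^sub>0" if c\<^sub>0: "c\<^sub>0 \<in> C" and pc: "(p, c) \<in> I c\<^sub>0" for p c c\<^sub>0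
  proof -
    obtain u where u: "c\<^sub>0 = vneg m \<boxplus> lattice_pt n d N u" "\<And>k. k < n \<Longrightarrow> 0 \<le> u k"
      using c\<^sub>0 by (auto simp: C_def lattice_cone_def)
    obtain w where w: "c = vneg m \<boxplus> lattice_pt n d N w" "\<And>k. k < n \<Longrightarrow> 0 \<le> w k"
      using pc by (auto simp: I_def C_def lattice_cone_def)
    have p: "b p \<noteq> 0" "p \<noteq> m" "p \<boxplus> c = m \<boxplus> c\<^sub>0" using pc by (auto simp: I_def)
    obtain v where v: "p = m \<boxplus> lattice_pt n d N v" "\<And>k. k < n \<Longrightarrow> 0 \<le> v k"
      using rootedD[OF b(1) p(1)] by (auto simp: lattice_cone_def)
    have "p \<boxplus> c = m \<boxplus> (vneg m \<boxplus> (lattice_pt n d N v \<boxplus> lattice_pt n d N w))"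
      by (simp add: v w vadd_ac)
    then have "lattice_pt n d N (\<lambda>k. v k + w k) = lattice_pt n d N u"
      using p(3) by (simp add: u lattice_pt_add cancel)
    then have "(\<Sum>k<n. u k) = (\<Sum>k<n. v k + w k)"
      using lattice_pt_inj[OF _ d] by (intro sum.cong) (auto simp: eq_commute)
    then have sum: "(\<Sum>k<n. u k) = (\<Sum>k<n. v k) + (\<Sum>k<n. w k)" by (simp add: sum.distrib)
    have "\<exists>k<n. v k \<noteq> 0"
    proof (rule ccontr)
      assume "\<not> ?thesis"
      then have "shear N v k = 0" if "k < n" for k using that by (simp add: shear_def)
      then have "p = m" using len by (auto simp: v(1) intro!: nth_equalityI)
      with p(2) show False ..
    qed
    then have "0 < (\<Sum>k<n. v k)" using v(2) by (force intro: sum_pos2)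
    moreover have "0 \<le> (\<Sum>k<n. w k)" using w(2) by (intro sum_nonneg) auto
    ultimately show ?thesis using sum by (simp add: u(1) w(1) height)
  qed
  \<comment> \<open>a series with every possible exponent of \<open>y\<close>, to bound the index sets of the recursion\<close>
  define ind :: "rat list \<Rightarrow> 'k" where "ind c = (if c \<in> C then 1 else 0)" for c
  have "rooted n d N (vneg m) ind" by (auto simp: rooted_def ind_def C_def)
  then have "ind \<in> carrier (series_ring n)"
    using rooted_carrier is_exponent_neg[OF m] d by blast
  moreover have "b \<in> carrier (series_ring n)" using rooted_carrier b m d by blast
  ultimately have "finite (splits b ind a)" for a using finite_splits by blast
  moreover have "I c\<^sub>0 \<subseteq> splits b ind (m \<boxplus> c\<^sub>0)" for c\<^sub>0
    by (auto simp: I_def splits_def ind_def)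
  ultimately have fin: "finite (I c\<^sub>0)" for c\<^sub>0 by (meson finite_subset)
  define F where "F y c\<^sub>0 =
    (if c\<^sub>0 \<in> C then (\<delta> (m \<boxplus> c\<^sub>0) - (\<Sum>(p, c)\<in>I c\<^sub>0. b p * y c)) / b m else 0)"
    for y c\<^sub>0
  define y where "y = wfrec (measure height) F"
  have y: "y c\<^sub>0 = F y c\<^sub>0" for c\<^sub>0
  proof -
    have "y c\<^sub>0 = F (cut y (measure height) c\<^sub>0) c\<^sub>0"
      unfolding y_def by (rule wfrec) simp
    also have "\<dots> = F y c\<^sub>0"
    proof (cases "c\<^sub>0 \<in> C")
      case True
      then have "(\<Sum>(p, c)\<in>I c\<^sub>0. b p * cut y (measure height) c\<^sub>0 c) = (\<Sum>(p, c)\<in>I c\<^sub>0. b p * y c)"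
        using decreasing by (intro sum.cong) (auto simp: cut_def)
      then show ?thesis by (simp add: F_def)
    qed (simp add: F_def)
    finally show ?thesis .
  qed
  have ysupp: "c \<in> C" if "y c \<noteq> 0" for c
    using that y[of c] by (auto simp: F_def split: if_splits)
  have root: "rooted n d N (vneg m) y" using ysupp by (auto simp: rooted_def C_def)
  have "conv b y a = \<delta> a" for a
  proof (cases "a \<in> ?G")
    case True
    define c\<^sub>0 where "c\<^sub>0 = vneg m \<boxplus> a"
    have c\<^sub>0: "m \<boxplus> c\<^sub>0 = a" "c\<^sub>0 \<in> C"
      using True cancel by (auto simp: c\<^sub>0_def C_def length_lattice_cone)
    have lenC: "length c = n" if "c \<in> C" for c
      using that len by (auto simp: C_def length_lattice_cone)
    have "conv b y a = (\<Sum>(p, c)\<in>insert (m, c\<^sub>0) (I c\<^sub>0). b p * y c)"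
    proof (rule conv_eq_sum)
      show "splits b y a \<subseteq> insert (m, c\<^sub>0) (I c\<^sub>0)"
      proof clarify
        fix p c assume "(p, c) \<in> splits b y a" "(p, c) \<notin> I c\<^sub>0"
        then have "p = m" and c: "c \<in> C" "p \<boxplus> c = a"
          using ysupp c\<^sub>0 by (auto simp: splits_def I_def)
        then show "p = m \<and> c = c\<^sub>0"
          using cancel(2)[OF lenC[OF c(1)]] by (simp add: c\<^sub>0_def)
      qed
    qed (use fin c\<^sub>0 in \<open>auto simp: I_def\<close>)
    also have "\<dots> = b m * y c\<^sub>0 + (\<Sum>(p, c)\<in>I c\<^sub>0. b p * y c)"
      by (subst sum.insert) (use fin in \<open>auto simp: I_def\<close>)
    also have "\<dots> = \<delta> a" using c\<^sub>0 b(2) by (simp add: y[of c\<^sub>0] F_def)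
    finally show ?thesis .
  next
    case False
    have "conv b y a = 0"
    proof (rule ccontr)
      assume "conv b y a \<noteq> 0"
      then have "a \<in> (\<boxplus>) (m \<boxplus> vneg m) ` ?G"
        using rooted_conv[OF b(1) root] by (auto simp: rooted_def)
      then show False using False cancel by (auto simp: vadd_assoc length_lattice_cone)
    qed
    moreover have "a \<noteq> replicate n 0" using False by auto
    ultimately show ?thesis by (simp add: \<delta>_def)
  qed
  then show ?thesis using root by (auto simp: \<delta>_def fun_eq_iff simp del: series_ring_simps)
qed

text \<open>
  The sums of an exponent of \<open>f\<close> and one of \<open>g\<close> lie in the cone based at \<open>e + e'\<close>, whose
  indicator function is itself a series. The triples are therefore covered by finitely many
  decompositions for that series and \<open>h\<close>, each refined in finitely many ways.
\<close>

lemma finite_triples_rooted: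
  fixes f g h :: "rat list \<Rightarrow> 'k::field"
  assumes f: "rooted n d N e f" "is_exponent n d e" and g: "rooted n d N e' g" "is_exponent n d e'"
    and d: "d > 0" and h: "h \<in> carrier (series_ring n)"
  shows "finite (triples f g h a)"
proof -
  define ind :: "rat list \<Rightarrow> 'k" where
    "ind q = (if q \<in> (\<boxplus>) (e \<boxplus> e') ` lattice_cone n d N then 1 else 0)" for q
  have "rooted n d N (e \<boxplus> e') ind" by (auto simp: rooted_def ind_def)
  then have ind: "ind \<in> carrier (series_ring n)"
    using rooted_carrier is_exponent_add[OF f(2) g(2)] d by blast
  have "triples f g h a \<subseteq> (\<Union>(s, r)\<in>splits ind h a. (\<lambda>(p, q). (p, q, r)) ` splits f g s)"
  proof
    fix x assume "x \<in> triples f g h a"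
    then obtain p q r where x: "x = (p, q, r)" "f p \<noteq> 0" "g q \<noteq> 0" "h r \<noteq> 0" "p \<boxplus> q \<boxplus> r = a"
      by (auto simp: triples_def)
    obtain u where u: "u \<in> lattice_cone n d N" "p = e \<boxplus> u"
      using rootedD[OF f(1) x(2)] by blast
    obtain v where v: "v \<in> lattice_cone n d N" "q = e' \<boxplus> v"
      using rootedD[OF g(1) x(3)] by blast
    have "p \<boxplus> q = e \<boxplus> e' \<boxplus> (u \<boxplus> v)" by (simp add: u v vadd_ac)
    then have "ind (p \<boxplus> q) \<noteq> 0"
      using lattice_cone_add[OF u(1) v(1)] by (auto simp: ind_def)
    then have "(p \<boxplus> q, r) \<in> splits ind h a" "(p, q) \<in> splits f g (p \<boxplus> q)"
      using x by (auto simp: splits_def)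
    then show "x \<in> (\<Union>(s, r)\<in>splits ind h a. (\<lambda>(p, q). (p, q, r)) ` splits f g s)"
      unfolding x(1) by force
  qed
  moreover have "finite (splits ind h a)" using ind h by (rule finite_splits)
  moreover have "finite (splits f g s)" for s
    by (rule finite_splits[OF rooted_carrier[OF f d] rooted_carrier[OF g d]])
  ultimately show ?thesis
    by (elim finite_subset) (auto intro!: finite_UN_I)
qed

text \<open>
  The inverse in the series ring is a definite description, so it equals the inverse just
  constructed only if there is no other one in the whole ring. That follows from
  \<open>z = (y b) z = y (b z) = y\<close>, where \<open>y\<close> and \<open>b\<close> are supported in cones but \<open>z\<close> is
  an arbitrary series.
\<close>

lemma inverse_rooted:
  fixes b :: "rat list \<Rightarrow> 'k::field"
  assumes b: "rooted n d N m b" "b m \<noteq> 0" and m: "is_exponent n d m" and d: "d > 0"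
  shows "rooted n d N (vneg m) (inv\<^bsub>series_ring n\<^esub> b)"
proof -
  let ?K = "series_ring n :: (rat list \<Rightarrow> 'k) ring"
  obtain y where y: "rooted n d N (vneg m) y" "conv b y = \<one>\<^bsub>?K\<^esub>"
    using rooted_right_inverse[OF assms] by blast
  have yK: "y \<in> carrier ?K" using rooted_carrier[OF y(1) is_exponent_neg[OF m] d] .
  have "inv\<^bsub>?K\<^esub> b = y" unfolding m_inv_def
  proof (rule the_equality)
    show "y \<in> carrier ?K \<and> b \<otimes>\<^bsub>?K\<^esub> y = \<one>\<^bsub>?K\<^esub> \<and> y \<otimes>\<^bsub>?K\<^esub> b = \<one>\<^bsub>?K\<^esub>"
      using y(2) yK by (simp only: series_ring_simps(1) conv_commute[of y b] simp_thms)
    fix z assume z: "z \<in> carrier ?K \<and> b \<otimes>\<^bsub>?K\<^esub> z = \<one>\<^bsub>?K\<^esub> \<and> z \<otimes>\<^bsub>?K\<^esub> b = \<one>\<^bsub>?K\<^esub>"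
    then have bz: "conv b z = \<one>\<^bsub>?K\<^esub>" by (simp only: series_ring_simps(1))
    have "z = conv \<one>\<^bsub>?K\<^esub> z" using conv_one z by metis
    also have "\<dots> = conv (conv y b) z" by (simp only: y(2) conv_commute[of y b])
    also have "\<dots> = conv y (conv b z)"
      using z by (intro conv_assoc finite_triples_rooted[OF y(1) is_exponent_neg[OF m] b(1) m d]) auto
    also have "\<dots> = conv \<one>\<^bsub>?K\<^esub> y" by (simp only: bz conv_commute)
    also have "\<dots> = y" using conv_one yK by metis
    finally show "z = y" .
  qed
  with y(1) show ?thesis by simp
qed


section \<open>Integral equations\<close>

lemma iter_laurent_add:
  "f \<in> iter_laurent n d \<Longrightarrow> g \<in> iter_laurent n d \<Longrightarrow> (\<lambda>q. f q + g q) \<in> iter_laurent n d"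
proof (induction n arbitrary: f g)
  case (Suc n)
  obtain N :: int where
    N: "\<And>p. (\<lambda>q. f (p # q)) \<noteq> (\<lambda>_. 0) \<Longrightarrow> \<exists>m\<ge>N. p = of_int m / of_nat d"
    using Suc.prems(1) by fastforce
  obtain M :: int where
    M: "\<And>p. (\<lambda>q. g (p # q)) \<noteq> (\<lambda>_. 0) \<Longrightarrow> \<exists>m\<ge>M. p = of_int m / of_nat d"
    using Suc.prems(2) by fastforce
  have "\<exists>m\<ge>min N M. p = of_int m / of_nat d" if nz: "(\<lambda>q. f (p # q) + g (p # q)) \<noteq> (\<lambda>_. 0)" for p
  proof -
    have "(\<lambda>q. f (p # q)) \<noteq> (\<lambda>_. 0) \<or> (\<lambda>q. g (p # q)) \<noteq> (\<lambda>_. 0)" using nz by (metis add_0)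
    then show ?thesis using N[of p] M[of p] by (meson min.coboundedI1 min.coboundedI2)
  qed
  then have "\<exists>N::int. \<forall>p. (\<lambda>q. f (p # q) + g (p # q)) \<noteq> (\<lambda>_. 0) \<longrightarrow>
      p \<in> {of_int m / of_nat d | m. m \<ge> N}" by blast
  with Suc show ?case by simp
qed simp

lemma zero_iter_laurent: "(\<lambda>_. 0) \<in> iter_laurent n d"
  by (induction n) auto

lemma abelian_monoid_series_ring: "abelian_monoid (series_ring n)"
proof (rule abelian_monoidI)
  fix f g :: "rat list \<Rightarrow> 'a"
  assume "f \<in> carrier (series_ring n)" "g \<in> carrier (series_ring n)"
  then obtain d d' where "d > 0" "d' > 0" "f \<in> iter_laurent n d" "g \<in> iter_laurent n d'"
    by (auto simp: carrier_series_ring)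
  then have "f \<in> iter_laurent n (d * d')" "g \<in> iter_laurent n (d * d')" "d * d' > 0"
    using iter_laurent_mono[of d "d * d'" n] iter_laurent_mono[of d' "d * d'" n] by auto
  then show "f \<oplus>\<^bsub>series_ring n\<^esub> g \<in> carrier (series_ring n)"
    using iter_laurent_add unfolding carrier_series_ring series_ring_simps by blast
next
  show "\<zero>\<^bsub>series_ring n\<^esub> \<in> carrier (series_ring n)"
    by (auto simp: carrier_series_ring zero_iter_laurent)
qed (auto simp: add_ac)

lemma finsum_series_ring:
  fixes m :: nat
  assumes "\<And>i. i < m \<Longrightarrow> t i \<in> carrier (series_ring n)"
  shows "(\<Oplus>\<^bsub>series_ring n\<^esub>i\<in>{..<m}. t i) a = (\<Sum>i<m. t i a)"
  using assms
proof (induction m)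
  case 0
  then show ?case
    by (simp add: abelian_monoid.finsum_empty[OF abelian_monoid_series_ring])
next
  case (Suc m)
  have "(\<Oplus>\<^bsub>series_ring n\<^esub>i\<in>insert m {..<m}. t i)
      = t m \<oplus>\<^bsub>series_ring n\<^esub> (\<Oplus>\<^bsub>series_ring n\<^esub>i\<in>{..<m}. t i)"
    using Suc.prems by (intro abelian_monoid.finsum_insert[OF abelian_monoid_series_ring]) auto
  with Suc show ?case by (simp add: lessThan_Suc)
qed

definition vscale :: "nat \<Rightarrow> rat list \<Rightarrow> rat list" where
  "vscale i e = map ((*) (of_nat i)) e"

lemma length_vscale [simp]: "length (vscale i e) = length e"
  by (simp add: vscale_def)

lemma nth_vscale [simp]: "k < length e \<Longrightarrow> vscale i e ! k = of_nat i * e ! k"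
  by (simp add: vscale_def)

lemma vscale_0: "vscale 0 e = replicate (length e) 0"
  by (rule nth_equalityI) auto

lemma vscale_add: "vscale (i + j) e = vscale i e \<boxplus> vscale j e"
  by (rule nth_equalityI) (auto simp: algebra_simps)

lemma vscale_Suc: "vscale (Suc i) e = vscale i e \<boxplus> e"
  by (rule nth_equalityI) (auto simp: algebra_simps)

lemma vscale_lattice_cone:
  assumes "g \<in> lattice_cone n d N"
  shows "vscale i g \<in> lattice_cone n d N"
  using assms
  by (induction i) (auto simp: vscale_0 vscale_Suc length_lattice_cone intro: lattice_cone_add)

lemma is_exponent_vscale: "is_exponent n d e \<Longrightarrow> is_exponent n d (vscale i e)"
proof (induction i)
  case 0
  then have "length e = n" by (simp add: is_exponent_def)
  then show ?case by (simp add: vscale_0 is_exponent_zero)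
qed (simp add: vscale_Suc is_exponent_add)

lemma rooted_power:
  fixes x :: "rat list \<Rightarrow> 'k::field"
  assumes x: "rooted n d N e x" and len: "length e = n" and d: "d > 0"
  shows "rooted n d N (vscale i e) (x [^]\<^bsub>series_ring n\<^esub> i)
    \<and> (x [^]\<^bsub>series_ring n\<^esub> i) (vscale i e) = x e ^ i"
proof (induction i)
  case 0
  show ?case by (auto simp: nat_pow_def vscale_0 len rooted_zero_iff)
next
  case (Suc i)
  have "x [^]\<^bsub>series_ring n\<^esub> Suc i = conv (x [^]\<^bsub>series_ring n\<^esub> i) x"
    by (simp add: nat_pow_def)
  then show ?case
    using Suc rooted_conv[OF _ x] conv_leading[OF _ x _ len d] len
    by (simp add: vscale_Suc mult.commute)
qed

text \<open>
  The leading monomial \<open>m e\<close> of \<open>x\<^sup>m\<close> has to be cancelled by some term \<open>c\<^sub>i x\<^sup>i\<close> with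
  \<open>i < m\<close>, whose exponents lie in \<open>i e + \<Gamma>\<close>. So \<open>(m - i) e\<close> lies in the cone, and adding
  \<open>m - i - 1\<close> copies of \<open>-e\<close> shows that \<open>e\<close> does. The conclusion enlarges both the
  denominator and the cone, in order to accommodate all the coefficients \<open>c\<^sub>i\<close> at once.
\<close>

lemma integral_exponent:
  fixes x :: "rat list \<Rightarrow> 'k::field"
  assumes int: "integral_over (series_ring n) (star_series n) x"
    and x: "rooted n d N e x" "x e \<noteq> 0" and e: "is_exponent n d e" and d: "d > 0"
    and neg: "vneg e \<in> lattice_cone n d N"
  shows "\<exists>d'>0. \<exists>N'. d dvd d' \<and> N \<le> N' \<and> e \<in> lattice_cone n d' N'"
proof -
  let ?K = "series_ring n :: (rat list \<Rightarrow> 'k) ring"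
  obtain m :: nat and c where c: "\<And>i. i < m \<Longrightarrow> c i \<in> star_series n" and
    eq: "x [^]\<^bsub>?K\<^esub> m \<oplus>\<^bsub>?K\<^esub> (\<Oplus>\<^bsub>?K\<^esub>i\<in>{..<m}. c i \<otimes>\<^bsub>?K\<^esub> x [^]\<^bsub>?K\<^esub> i) = \<zero>\<^bsub>?K\<^esub>"
    using int unfolding integral_over_def by blast
  obtain ds Ns where ds: "\<And>i. i < m \<Longrightarrow> ds i > 0"
      "\<And>i. i < m \<Longrightarrow> rooted n (ds i) (Ns i) (replicate n 0) (c i)"
    using c unfolding star_series_iff by metis
  define D where "D = d * (\<Prod>i<m. ds i)"
  define M where "M = N + (\<Sum>i<m. Ns i)"
  have D: "D > 0" "d dvd D" using d ds by (auto simp: D_def intro: prod_pos)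
  have M: "N \<le> M" by (simp add: M_def)
  have cr: "rooted n D M (replicate n 0) (c i)" if "i < m" for i
  proof (rule rooted_mono[OF ds(2)[OF that]])
    show "ds i dvd D" unfolding D_def using that by (intro dvd_mult dvd_prodI) auto
    have "Ns i \<le> (\<Sum>i<m. Ns i)" using that by (intro member_le_sum) auto
    then show "Ns i \<le> M" by (simp add: M_def)
  qed (rule D)
  have xr: "rooted n D M e x" using rooted_mono[OF x(1) D(2,1) M] .
  have len: "length e = n" using e by (simp add: is_exponent_def)
  have eD: "is_exponent n D e"
  proof -
    have "vneg e \<in> lattice_cone n D M"
      using neg lattice_cone_refine[OF D(2,1)] lattice_cone_mono[OF M] by blast
    then have "is_exponent n D (vneg (vneg e))"
      using is_exponent_neg is_exponent_lattice_cone by blast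
    moreover have "vneg (vneg e) = e" by (simp add: vneg_def comp_def)
    ultimately show ?thesis by simp
  qed
  note pow = rooted_power[OF xr len D(1)]
  have summand: "rooted n D M (vscale i e) (c i \<otimes>\<^bsub>?K\<^esub> x [^]\<^bsub>?K\<^esub> i)" if "i < m" for i
    using rooted_conv[OF cr[OF that] conjunct1[OF pow[of i]]] len by simp
  have "(x [^]\<^bsub>?K\<^esub> m \<oplus>\<^bsub>?K\<^esub> (\<Oplus>\<^bsub>?K\<^esub>i\<in>{..<m}. c i \<otimes>\<^bsub>?K\<^esub> x [^]\<^bsub>?K\<^esub> i)) (vscale m e)
      = x e ^ m + (\<Sum>i<m. (c i \<otimes>\<^bsub>?K\<^esub> x [^]\<^bsub>?K\<^esub> i) (vscale m e))"
    using summand is_exponent_vscale[OF eD] D(1) pow[of m]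
    by (subst series_ring_simps(4), subst finsum_series_ring) (blast intro: rooted_carrier, simp)
  then have "(\<Sum>i<m. (c i \<otimes>\<^bsub>?K\<^esub> x [^]\<^bsub>?K\<^esub> i) (vscale m e)) \<noteq> 0"
    unfolding eq using x(2) by auto
  then obtain i where i: "i < m" "(c i \<otimes>\<^bsub>?K\<^esub> x [^]\<^bsub>?K\<^esub> i) (vscale m e) \<noteq> 0"
    by (meson lessThan_iff sum.not_neutral_contains_not_neutral)
  obtain g where g: "g \<in> lattice_cone n D M" "vscale m e = vscale i e \<boxplus> g"
    using rootedD[OF summand[OF i(1)] i(2)] by blast
  \<comment> \<open>\<open>e = (m - i) e + (m - i - 1) (- e)\<close> with \<open>m - i - 1 = j\<close>\<close>
  obtain j where j: "m = i + Suc j" using i(1) by (metis less_iff_Suc_add add_Suc_right)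
  have "g = vscale (Suc j) e"
    using g by (simp add: j vscale_add vadd_left_cancel len length_lattice_cone del: add_Suc_right)
  then have "e = g \<boxplus> vscale j (vneg e)"
    using len by (auto intro!: nth_equalityI simp: algebra_simps)
  moreover have "vscale j (vneg e) \<in> lattice_cone n D M"
    using neg lattice_cone_refine[OF D(2,1)] lattice_cone_mono[OF M] vscale_lattice_cone by blast
  ultimately have "e \<in> lattice_cone n D M" using lattice_cone_add[OF g(1)] by metis
  with D M show ?thesis by blast
qed

lemma quotient_field_rooted:
  fixes x :: "rat list \<Rightarrow> 'k::field"
  assumes "x \<in> quotient_field (series_ring n) (star_series n)"
  shows "\<exists>d>0. \<exists>N e. is_exponent n d e \<and> rooted n d N e x"
proof -
  let ?K = "series_ring n :: (rat list \<Rightarrow> 'k) ring"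
  obtain a b where a: "a \<in> star_series n" and b: "b \<in> star_series n" "b \<noteq> (\<lambda>_. 0)"
    and x: "x = conv a (inv\<^bsub>?K\<^esub> b)"
    using assms by (auto simp: quotient_field_def)
  obtain d\<^sub>1 N\<^sub>1 where a1: "d\<^sub>1 > 0" "rooted n d\<^sub>1 N\<^sub>1 (replicate n 0) a"
    using a star_series_iff by blast
  obtain d\<^sub>2 N\<^sub>2 where b2: "d\<^sub>2 > 0" "rooted n d\<^sub>2 N\<^sub>2 (replicate n 0) b"
    using b(1) star_series_iff by blast
  define d where "d = d\<^sub>1 * d\<^sub>2"
  have d: "d > 0" "d\<^sub>1 dvd d" "d\<^sub>2 dvd d" using a1 b2 by (auto simp: d_def)
  have bd: "rooted n d N\<^sub>2 (replicate n 0) b" using rooted_mono[OF b2(2) d(3,1) order_refl] .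
  have "{q. b q \<noteq> 0} \<noteq> {}" using b(2) by auto
  then obtain m N where m: "b m \<noteq> 0" "rooted n d N m b"
    using least_exponent[of "{q. b q \<noteq> 0}"] bd unfolding rooted_def by blast
  have "is_exponent n d m"
    using m(1) bd is_exponent_lattice_cone by (auto simp: rooted_zero_iff)
  then have neg: "is_exponent n d (vneg m)"
    and "rooted n d N (vneg m) (inv\<^bsub>?K\<^esub> b)"
    using is_exponent_neg inverse_rooted[OF m(2,1) _ d(1)] by blast+
  then have "rooted n d (max N\<^sub>1 N) (vneg m) (inv\<^bsub>?K\<^esub> b)"
    using rooted_mono[OF _ dvd_refl d(1)] by fastforce
  moreover have "rooted n d (max N\<^sub>1 N) (replicate n 0) a"
    using rooted_mono[OF a1(2) d(2,1)] by simp
  ultimately have "rooted n d (max N\<^sub>1 N) (replicate n 0 \<boxplus> vneg m) x"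
    unfolding x by (rule rooted_conv[rotated])
  with d(1) neg is_exponent_add[OF is_exponent_zero neg] show ?thesis by blast
qed

theorem theorem30:
  fixes n :: nat
  assumes "n > 1"
  shows "integrally_closed (series_ring n)
    (star_series n :: (rat list \<Rightarrow> 'k::{alg_closed_field, field_char_0}) set)"
  unfolding integrally_closed_def
proof (intro ballI impI)
  fix x :: "rat list \<Rightarrow> 'k"
  assume "x \<in> quotient_field (series_ring n) (star_series n)"
    and int: "integral_over (series_ring n) (star_series n) x"
  then obtain d N\<^sub>0 e\<^sub>0 where d: "d > 0" and e\<^sub>0: "is_exponent n d e\<^sub>0"
    and x\<^sub>0: "rooted n d N\<^sub>0 e\<^sub>0 x"
    using quotient_field_rooted by blast
  show "x \<in> star_series n"
  proof (cases "\<exists>q. x q \<noteq> 0")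
    case False
    then have "rooted n d N\<^sub>0 (replicate n 0) x" by (simp add: rooted_def)
    with d show ?thesis using star_series_iff by blast
  next
    case True
    then obtain e N where e: "x e \<noteq> 0" "rooted n d N e x"
      using least_exponent[of "{q. x q \<noteq> 0}"] x\<^sub>0 unfolding rooted_def by blast
    have exp: "is_exponent n d e"
      using rootedD[OF x\<^sub>0 e(1)] is_exponent_add[OF e\<^sub>0 is_exponent_lattice_cone] by blast
    have "\<exists>d'>0. \<exists>N'. d dvd d' \<and> N \<le> N' \<and> e \<in> lattice_cone n d' N'"
    proof -
      obtain N\<^sub>1 where "e \<in> lattice_cone n d N\<^sub>1 \<or> vneg e \<in> lattice_cone n d N\<^sub>1"
        using lattice_cone_total[of e n d] exp unfolding is_exponent_def by blast
      then consider "e \<in> lattice_cone n d (max N N\<^sub>1)" | "vneg e \<in> lattice_cone n d (max N N\<^sub>1)"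
        using lattice_cone_mono[of N\<^sub>1 "max N N\<^sub>1" n d] by auto
      then show ?thesis
      proof cases
        case 1
        show ?thesis
          by (intro exI[of _ d] exI[of _ "max N N\<^sub>1"] conjI) (use d 1 in simp_all)
      next
        case 2
        have "rooted n d (max N N\<^sub>1) e x" using rooted_mono[OF e(2) dvd_refl d] by simp
        from integral_exponent[OF int this e(1) exp d 2] obtain d' N' where
          "d' > 0" "d dvd d'" "max N N\<^sub>1 \<le> N'" "e \<in> lattice_cone n d' N'"
          by (elim exE conjE)
        then show ?thesis by (intro exI[of _ d'] exI[of _ N'] conjI) simp_all
      qed
    qed
    then obtain d' N' where d': "d' > 0" "d dvd d'" "N \<le> N'" "e \<in> lattice_cone n d' N'"
      by (elim exE conjE)
    have "(\<boxplus>) e ` lattice_cone n d' N' \<subseteq> lattice_cone n d' N'"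
      using lattice_cone_add[OF d'(4)] by blast
    then have "rooted n d' N' (replicate n 0) x"
      using rooted_mono[OF e(2) d'(2,1,3)] unfolding rooted_zero_iff by (auto simp: rooted_def)
    with d'(1) show ?thesis using star_series_iff by blast
  qed
qed

end
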